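(* For every dimension $n$ there exists a constant $C$, depending only on $n$, such that the following holds. Let $0\leq\delta<1$, $1\leq q\leq \frac{n}{n-\delta}$, $\alpha=n-q(n-\delta)$, let $f\in L^1_{\mathrm{loc}}(\mathbb R^n)$ and let $\mu$ be a Radon measure on $\mathbb R^n$ with $\mu\ll\mathcal L$. Then \[ \biggl(\int_Q |f-f_Q|^q\,d\mu\biggr)^{\frac1q} \leq C(1-\delta)\int_Q\int_Q \frac{|f(x)-f(y)|}{|x-y|^{n+\delta}}\,dy\,\bigl(\mathrm M^{\mathrm d}_{\alpha,Q}\mu(x)\bigr)^{\frac1q}\,dx \] for every cube $Q\subset\mathbb R^n$. Alternatively, $\mu$ may be an arbitrary Radon measure (not necessarily absolutely continuous), and then the same inequality holds for every continuous function $f$.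
   Context: $\mathcal L$ is Lebesgue measure on $\mathbb R^n$; $\mu\ll\mathcal L$ means that $\mathcal L(A)=0$ implies $\mu(A)=0$. $|x|$ is the Euclidean norm. A cube is a closed axis-parallel cube $[a_1,a_1+l]\times\dots\times[a_n,a_n+l]$, with side length $\mathrm l(Q)=l>0$. $f_Q=\frac1{\mathcal L(Q)}\int_Q f\,dx$ is the Lebesgue average of $f$ over $Q$. For a cube $Q$, $\mathcal D_k(Q)$ ($k\in\mathbb N_0$) is the collection of the $2^{kn}$ (closed) dyadic subcubes of $Q$ of side length $2^{-k}\mathrm l(Q)$ with pairwise disjoint interiors obtained by repeatedly bisecting the sides of $Q$, and $\mathcal D(Q)=\bigcup_{k\ge0}\mathcal D_k(Q)$. The local dyadic fractional maximal function is \[ \mathrm M^{\mathrm d}_{\alpha,Q}\mu(x)=\sup_{Q'\ni x,\;Q'\in\mathcal D(Q)}\mathrm l(Q')^{\alpha}\,\frac{\mu(Q')}{\mathcal L(Q')} . \] *)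

theory Defs
  imports "HOL-Analysis.Analysis"
begin

(* Real powers on [0,\<infinity>] with top^p = top; meant for exponents p > 0 only. *)
definition ennreal_powr :: "ennreal \<Rightarrow> real \<Rightarrow> ennreal" (infixr \<open>epowr\<close> 80) where
  "x epowr p = (if x = top then top else ennreal (enn2real x powr p))"

definition locally_integrable :: "(real ^ 'n \<Rightarrow> real) \<Rightarrow> bool" where
  "locally_integrable f \<longleftrightarrow> (\<forall>K. compact K \<longrightarrow> set_integrable lebesgue K f)"

(* On Euclidean space both regularity clauses follow from the first two. *)
definition radon_measure :: "'a::euclidean_space measure \<Rightarrow> bool" where
  "radon_measure \<mu> \<longleftrightarrow>
     sets \<mu> = sets borel \<and>
     (\<forall>K. compact K \<longrightarrow> emeasure \<mu> K < top) \<and>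
     (\<forall>A\<in>sets borel. emeasure \<mu> A = (INF U\<in>{U. open U \<and> A \<subseteq> U}. emeasure \<mu> U)) \<and>
     (\<forall>U. open U \<longrightarrow> emeasure \<mu> U = (SUP K\<in>{K. compact K \<and> K \<subseteq> U}. emeasure \<mu> K))"

(* Cubes are represented by their lowest corner a and side length l. *)
definition cube :: "real ^ 'n \<Rightarrow> real \<Rightarrow> (real ^ 'n) set" where
  "cube a l = cbox a (a + (\<chi> i. l))"

(* The 2^n cubes obtained by halving every side; S is the set of coordinates in which the
   upper half is taken. *)
definition bisect :: "(real ^ 'n) \<times> real \<Rightarrow> ((real ^ 'n) \<times> real) set" where
  "bisect = (\<lambda>(a, l). range (\<lambda>S. (a + (\<chi> i. if i \<in> S then l / 2 else 0), l / 2)))"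

primrec dyadic_level :: "nat \<Rightarrow> (real ^ 'n) \<times> real \<Rightarrow> ((real ^ 'n) \<times> real) set" where
  "dyadic_level 0 Q = {Q}"
| "dyadic_level (Suc k) Q = (\<Union>Q'\<in>dyadic_level k Q. bisect Q')"

definition dyadic_subcubes :: "real ^ 'n \<Rightarrow> real \<Rightarrow> ((real ^ 'n) \<times> real) set" where
  "dyadic_subcubes a l = (\<Union>k. dyadic_level k (a, l))"

definition dyadic_frac_maximal ::
    "real \<Rightarrow> real ^ 'n \<Rightarrow> real \<Rightarrow> (real ^ 'n) measure \<Rightarrow> real ^ 'n \<Rightarrow> ennreal" where
  "dyadic_frac_maximal \<alpha> a l \<mu> x =
     (SUP (b, s)\<in>{(b, s). (b, s) \<in> dyadic_subcubes a l \<and> x \<in> cube b s}.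
        ennreal (s powr \<alpha>) * (emeasure \<mu> (cube b s) / emeasure lebesgue (cube b s)))"

definition average :: "(real ^ 'n \<Rightarrow> real) \<Rightarrow> (real ^ 'n) set \<Rightarrow> real" where
  "average f Q = (LINT x:Q|lebesgue. f x) / measure lebesgue Q"

lemma dyadic_level_eq:
  fixes a :: "real ^ 'n"
  shows "dyadic_level k (a, l) =
    {(a + (\<chi> i. real (m i) * (l / 2 ^ k)), l / 2 ^ k) | m. \<forall>i. m i < 2 ^ k}"
proof (induction k)
  case 0
  show ?case by (auto simp: vec_eq_iff)
next
  case (Suc k)
  let ?P = "\<lambda>k m. (a + (\<chi> i. real (m i) * (l / 2 ^ k)), l / 2 ^ k)"
  have 1: "bisect (?P k m) = range (\<lambda>S. ?P (Suc k) (\<lambda>i. 2 * m i + (if i \<in> S then 1 else 0)))"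
    for m :: "'n \<Rightarrow> nat"
    unfolding bisect_def by (auto simp: vec_eq_iff algebra_simps image_iff add_divide_distrib)
  have "dyadic_level (Suc k) (a, l) = (\<Union>m\<in>{m. \<forall>i. m i < 2 ^ k}. bisect (?P k m))"
    using Suc by auto
  also have "\<dots> = {?P (Suc k) m | m. \<forall>i. m i < 2 ^ Suc k}" (is "?L = ?R")
  proof
    show "?L \<subseteq> ?R"
    proof
      fix c assume "c \<in> ?L"
      then obtain m S where m: "\<forall>i. m i < 2 ^ k"
        and c: "c = ?P (Suc k) (\<lambda>i. 2 * m i + (if i \<in> S then 1 else 0))"
        unfolding 1 by blast
      define m' where "m' = (\<lambda>i. 2 * m i + (if i \<in> S then 1 else 0))"
      have "m' i < 2 ^ Suc k" for i
        unfolding m'_def using m[rule_format, of i] by auto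
      moreover have "c = ?P (Suc k) m'" unfolding m'_def by (fact c)
      ultimately show "c \<in> ?R" by blast
    qed
    show "?R \<subseteq> ?L"
    proof
      fix c assume "c \<in> ?R"
      then obtain m where m: "\<forall>i. m i < 2 ^ Suc k" and c: "c = ?P (Suc k) m" by blast
      define m' where "m' = (\<lambda>i. m i div 2)"
      define S where "S = {i. odd (m i)}"
      have "m = (\<lambda>i. 2 * m' i + (if i \<in> S then 1 else 0))"
        unfolding m'_def S_def by (rule ext) auto
      with c have "c \<in> bisect (?P k m')" unfolding 1 by blast
      moreover have "m' i < 2 ^ k" for i
        unfolding m'_def using m[rule_format, of i] by (simp add: less_mult_imp_div_less)
      ultimately show "c \<in> ?L" by blast
    qed
  qed
  finally show ?case .
qed

end

(*
Splitting f at a median on Q and slicing into level sets, the coarea formula reduces the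
inequality to a set E of density at most 1/2 in Q. Cover E by the maximal dyadic subcubes Q' in
which E has density above 2^(-n-1); passing to the dyadic parent shows that this density is also at
most 1/2. The relative isoperimetric inequality on Q' gives l(Q')^(n-delta) <= C (1-delta) times the
fractional energy of E in Q', while (n-alpha)/q = n-delta makes
mu(Q')^(1/q) = l(Q')^(n-delta) (l(Q')^alpha mu(Q')/|Q'|)^(1/q), whose second factor is bounded by
the maximal function at every point of Q'. As 1/q <= 1, the mu(Q')^(1/q) may be summed.
*)

theory Submission
  imports Defs
begin

section \<open>The fractional Poincare inequality on convex sets\<close>

text \<open>The two alternatives of the theorem enter through one requirement on a level set E:
  \<mu>-almost every point of E in Q must lie in a dyadic subcube where E has Lebesgue density above
  the threshold. For \<mu> absolutely continuous this is a weak density theorem; for continuous f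
  the level sets are open and it holds at every point, so \<mu> may charge Lebesgue null sets. A
  median m is subtracted, and not the mean, because all level sets of both parts of f - m then fill
  at most half of Q, which is what the stopping argument needs at the root. The price is the
  distance from median to mean; it is bounded by a separate L1 estimate that uses the isoperimetric
  inequality on Q alone. The threshold 2^(-n-1) is one half of the volume ratio of a child to its
  parent. The constant must not depend on \<delta>, so the factor 1 - \<delta> has to come out of
  the isoperimetric inequality explicitly; comparing oscillations at scale r and r/2 provides
  this.\<close>

lemma nn_integral_lborel_affine:
  fixes h :: "'a::euclidean_space \<Rightarrow> ennreal"
  assumes [measurable]: "h \<in> borel_measurable borel" and c: "c \<noteq> 0"
  shows "(\<integral>\<^sup>+x. h x \<partial>lborel) = ennreal (\<bar>c\<bar> ^ DIM('a)) * (\<integral>\<^sup>+x. h (t + c *\<^sub>R x) \<partial>lborel)"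
  by (subst lborel_affine[OF c, of t])
     (simp add: nn_integral_density nn_integral_distr nn_integral_cmult)

text \<open>Truncating to pairs at distance at most \<open>r\<close> turns the comparison of
  neighbouring scales into a recursion. Values in \<open>ennreal\<close> avoid any integrability
  assumption on \<open>f\<close>.\<close>

definition osc :: "('a::euclidean_space \<Rightarrow> real) \<Rightarrow> 'a set \<Rightarrow> real \<Rightarrow> ennreal" where
  "osc f K r = (\<integral>\<^sup>+x. \<integral>\<^sup>+y. indicator K x * indicator K y * indicator {..r} (dist x y) *
     ennreal \<bar>f x - f y\<bar> \<partial>lborel \<partial>lborel)"

text \<open>Go from \<open>x\<close> to \<open>y\<close> through the midpoint: the substitution \<open>z = (x + y) / 2\<close> has Jacobian
  \<open>2\<^sup>n\<close>, and both halves contribute equally.\<close>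

lemma osc_halve:
  fixes f :: "'a::euclidean_space \<Rightarrow> real"
  assumes [measurable]: "f \<in> borel_measurable borel" "K \<in> sets borel" and K: "convex K"
  shows "osc f K r \<le> 2 ^ (DIM('a) + 1) * osc f K (r / 2)"
proof -
  define m where "m x y = (1/2) *\<^sub>R x + (1/2) *\<^sub>R y" for x y :: 'a
  define h where "h x z = indicator K x * indicator K z * indicator {..r/2} (dist x z) *
     ennreal \<bar>f x - f z\<bar>" for x z
  have [measurable]: "(\<lambda>(x, y). m x y) \<in> borel_measurable (lborel \<Otimes>\<^sub>M lborel)"
    unfolding m_def by measurable
  have hm [measurable]: "(\<lambda>(x, y). h x y) \<in> borel_measurable (lborel \<Otimes>\<^sub>M lborel)"
    unfolding h_def by measurable
  have m_in: "m x y \<in> K" if "x \<in> K" "y \<in> K" for x y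
    unfolding m_def using that K by (auto intro!: convexD)
  have dx: "dist x (m x y) = dist x y / 2" "dist y (m x y) = dist x y / 2" for x y
  proof -
    have "x - m x y = (1/2) *\<^sub>R (x - y)" "y - m x y = (1/2) *\<^sub>R (y - x)"
      unfolding m_def by (simp_all add: algebra_simps flip: scaleR_add_left)
    then show "dist x (m x y) = dist x y / 2" "dist y (m x y) = dist x y / 2"
      by (simp_all add: dist_norm norm_minus_commute)
  qed
  have m_comm: "m x y = m y x" for x y by (simp add: m_def)
  \<comment> \<open>Convexity keeps the midpoint in \<open>K\<close>, and it has distance
    \<open>dist x y / 2\<close> from both ends, so both halves of the path are admissible at scale
    \<open>r / 2\<close>.\<close>
  have tri: "indicator K x * indicator K y * indicator {..r} (dist x y) * ennreal \<bar>f x - f y\<bar>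
      \<le> h x (m x y) + h y (m x y)" for x y
  proof (cases "x \<in> K \<and> y \<in> K \<and> dist x y \<le> r")
    case True
    have "\<bar>f x - f y\<bar> \<le> \<bar>f x - f (m x y)\<bar> + \<bar>f y - f (m x y)\<bar>" by simp
    then have "ennreal \<bar>f x - f y\<bar> \<le> ennreal \<bar>f x - f (m x y)\<bar> + ennreal \<bar>f y - f (m x y)\<bar>"
      by (simp flip: ennreal_plus)
    with True m_in[of x y] show ?thesis by (simp add: h_def dx)
  qed (auto simp: indicator_def)
  have sub: "(\<integral>\<^sup>+y. h x (m x y) \<partial>lborel) = 2 ^ DIM('a) * (\<integral>\<^sup>+z. h x z \<partial>lborel)" for x
  proof -
    have [measurable]: "h x \<in> borel_measurable borel" unfolding h_def by measurable
    have "(2::ennreal) ^ DIM('a) * ennreal ((1/2) ^ DIM('a)) = ennreal (2 ^ DIM('a) * (1/2) ^ DIM('a))"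
      by (simp add: ennreal_mult ennreal_power[symmetric] ennreal_numeral[symmetric] del: ennreal_numeral)
    also have "\<dots> = 1" by (simp flip: power_mult_distrib)
    finally have "2 ^ DIM('a) * ennreal ((1/2) ^ DIM('a)) = 1" .
    then show ?thesis
      by (subst (2) nn_integral_lborel_affine[where c = "1/2" and t = "(1/2) *\<^sub>R x"])
         (simp_all add: m_def mult.assoc[symmetric])
  qed
  have "osc f K r \<le> (\<integral>\<^sup>+x. \<integral>\<^sup>+y. h x (m x y) + h y (m x y) \<partial>lborel \<partial>lborel)"
    unfolding osc_def by (intro nn_integral_mono tri)
  also have "\<dots> = (\<integral>\<^sup>+x. (\<integral>\<^sup>+y. h x (m x y) \<partial>lborel) + (\<integral>\<^sup>+y. h y (m x y) \<partial>lborel) \<partial>lborel)"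
    by (intro nn_integral_cong nn_integral_add) measurable
  also have "\<dots> = (\<integral>\<^sup>+x. \<integral>\<^sup>+y. h x (m x y) \<partial>lborel \<partial>lborel) + (\<integral>\<^sup>+x. \<integral>\<^sup>+y. h y (m x y) \<partial>lborel \<partial>lborel)"
    by (intro nn_integral_add) measurable
  also have "(\<integral>\<^sup>+x. \<integral>\<^sup>+y. h y (m x y) \<partial>lborel \<partial>lborel) = (\<integral>\<^sup>+y. \<integral>\<^sup>+x. h y (m x y) \<partial>lborel \<partial>lborel)"
    by (rule lborel_pair.Fubini') measurable
  also have "\<dots> = (\<integral>\<^sup>+y. \<integral>\<^sup>+x. h y (m y x) \<partial>lborel \<partial>lborel)"
    by (subst m_comm) (rule refl)
  also have "(\<integral>\<^sup>+x. \<integral>\<^sup>+y. h x (m x y) \<partial>lborel \<partial>lborel) = 2 ^ DIM('a) * osc f K (r / 2)"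
    unfolding sub by (subst nn_integral_cmult) (simp_all add: osc_def h_def[abs_def])
  finally show ?thesis by (simp add: mult_2 distrib_right)
qed

lemma osc_halve_iterate:
  fixes f :: "'a::euclidean_space \<Rightarrow> real"
  assumes "f \<in> borel_measurable borel" "K \<in> sets borel" "convex K"
  shows "osc f K r \<le> 2 ^ (j * (DIM('a) + 1)) * osc f K (r / 2 ^ j)"
proof (induction j)
  case (Suc j)
  have "osc f K (r / 2 ^ j) \<le> 2 ^ (DIM('a) + 1) * osc f K (r / 2 ^ Suc j)"
    using osc_halve[OF assms, of "r / 2 ^ j"] by (simp add: mult.commute)
  from mult_left_mono[OF this, of "2 ^ (j * (DIM('a) + 1))"] Suc
  show ?case by (simp add: power_add mult_ac)
qed simp

text \<open>Only scales with 2^j \<le> R / r contribute. The ratio \<open>2 powr p\<close> is at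
  least 2, so a partial geometric sum is at most twice its last term, and that term is at most
  \<open>(R / r) powr p\<close>, uniformly in \<open>N\<close>.\<close>

lemma sum_dyadic_powr_le:
  fixes r R p :: real
  assumes r: "0 < r" and R: "0 < R" and p: "1 \<le> p"
  shows "(\<Sum>j<N. indicator {..R / 2 ^ j} r * (2 powr p) ^ j) \<le> 2 * (R / r) powr p"
proof (induction N)
  case (Suc N)
  have b: "2 \<le> 2 powr p" using powr_mono[of 1 p 2] p by simp
  have S: "(\<Sum>j<N. (2 powr p) ^ j) \<le> (2 powr p) ^ N"
  proof (induction N)
    case (Suc N)
    have "(2 powr p) ^ N + (2 powr p) ^ N \<le> (2 powr p) * (2 powr p) ^ N"
      using mult_right_mono[OF b, of "(2 powr p) ^ N"] by simp
    with Suc show ?case by (simp only: sum.lessThan_Suc power_Suc)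
  qed simp
  show ?case
  proof (cases "r \<le> R / 2 ^ N")
    case True
    have "(\<Sum>j<N. indicator {..R / 2 ^ j} r * (2 powr p) ^ j) \<le> (\<Sum>j<N. (2 powr p) ^ j)"
      by (intro sum_mono) (auto simp: indicator_def)
    with S have "(\<Sum>j<Suc N. indicator {..R / 2 ^ j} r * (2 powr p) ^ j) \<le> 2 * (2 powr p) ^ N"
      using True by simp
    also have "(2 powr p) ^ N = (2 ^ N) powr p"
      by (simp add: powr_powr powr_realpow[symmetric] mult.commute)
    also have "(2 ^ N) powr p \<le> (R / r) powr p"
      using True r p by (intro powr_mono2) (auto simp: field_simps)
    finally show ?thesis by simp
  next
    case False
    then show ?thesis using Suc by simp
  qed
qed (use r R in simp)

text \<open>Summing the halving inequality over all scales \<open>R / 2\<^sup>j\<close> gives a geometric series of ratio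
  \<open>2 powr (\<delta> - 1)\<close>; its sum is at least \<open>1 / (1 - \<delta>)\<close>, which is the source of the factor
  \<open>1 - \<delta>\<close>.\<close>

lemma osc_le_fractional_energy:
  fixes f :: "'a::euclidean_space \<Rightarrow> real"
  assumes [measurable]: "f \<in> borel_measurable borel" "K \<in> sets borel" and K: "convex K"
    and diam: "\<And>x y. x \<in> K \<Longrightarrow> y \<in> K \<Longrightarrow> dist x y \<le> R" and R: "0 < R"
    and \<delta>: "0 \<le> \<delta>" "\<delta> < 1"
  defines "p \<equiv> real DIM('a) + \<delta>"
  shows "(\<integral>\<^sup>+x. \<integral>\<^sup>+y. indicator K x * indicator K y * ennreal \<bar>f x - f y\<bar> \<partial>lborel \<partial>lborel)
    \<le> ennreal (2 * (1 - \<delta>) * R powr p) *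
      (\<integral>\<^sup>+x. \<integral>\<^sup>+y. indicator K x * indicator K y * ennreal (\<bar>f x - f y\<bar> / norm (x - y) powr p)
        \<partial>lborel \<partial>lborel)"
    (is "?L \<le> _ * ?I")
proof -
  have p: "1 \<le> p" unfolding p_def using \<delta> DIM_positive[where 'a='a] by linarith
  have L: "?L = osc f K R"
    unfolding osc_def using diam by (intro nn_integral_cong) (auto simp: indicator_def)
  \<comment> \<open>Since p = (n + 1) + (\<delta> - 1), the weight is the loss 2^(j(n+1)) of j
    halvings times the j-th power of the ratio \<open>2 powr (\<delta> - 1)\<close>. Summed against
    the truncations, the weights rebuild the kernel of exponent p.\<close>
  define w where "w j = ennreal ((2 powr p) ^ j)" for j
  have w: "w j = ennreal ((2 powr (\<delta> - 1)) ^ j) * 2 ^ (j * (DIM('a) + 1))" for j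
  proof -
    have "(2 powr p) ^ j = 2 powr (p * j)" by (simp add: powr_power mult.commute)
    also have "\<dots> = 2 powr ((\<delta> - 1) * j) * 2 powr (real (j * (DIM('a) + 1)))"
      unfolding p_def by (simp add: powr_add[symmetric] algebra_simps)
    also have "\<dots> = (2 powr (\<delta> - 1)) ^ j * 2 ^ (j * (DIM('a) + 1))"
      by (simp only: powr_realpow) (simp add: powr_power mult.commute)
    finally show ?thesis
      by (simp add: w_def ennreal_mult ennreal_power[symmetric] ennreal_numeral[symmetric] del: ennreal_numeral)
  qed
  have geom: "ennreal (1 / (1 - \<delta>)) \<le> (\<Sum>j. ennreal ((2 powr (\<delta> - 1)) ^ j))"
  proof -
    have lt: "2 powr (\<delta> - 1) < 1" using \<delta> by (simp add: powr_less_one)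
    \<comment> \<open>From exp x \<ge> 1 + x at x = (\<delta> - 1) ln 2, together with ln 2 <
      1.\<close>
    have "1 - 2 powr (\<delta> - 1) \<le> 1 - \<delta>"
    proof -
      have "1 + (\<delta> - 1) * ln 2 \<le> 2 powr (\<delta> - 1)"
        unfolding powr_def using exp_ge_add_one_self[of "(\<delta> - 1) * ln 2"] by simp
      moreover have "(1 - \<delta>) * ln 2 \<le> (1 - \<delta>) * 1"
        using \<delta> ln_2_less_1 by (intro mult_left_mono) auto
      ultimately show ?thesis by (simp add: algebra_simps)
    qed
    then have "1 / (1 - \<delta>) \<le> 1 / (1 - 2 powr (\<delta> - 1))"
      using lt \<delta> by (intro divide_left_mono mult_pos_pos) auto
    then have "ennreal (1 / (1 - \<delta>)) \<le> ennreal (1 / (1 - 2 powr (\<delta> - 1)))"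
      by (rule ennreal_leI)
    also have "\<dots> = (\<Sum>j. ennreal ((2 powr (\<delta> - 1)) ^ j))"
      using lt by (intro suminf_ennreal_eq[symmetric] geometric_sums) auto
    finally show ?thesis .
  qed
  have pt: "(\<Sum>j. w j * (indicator K x * indicator K y * indicator {..R / 2 ^ j} (dist x y) * ennreal \<bar>f x - f y\<bar>))
    \<le> ennreal (2 * R powr p) * (indicator K x * indicator K y * ennreal (\<bar>f x - f y\<bar> / norm (x - y) powr p))" for x y
  proof (cases "x \<in> K \<and> y \<in> K \<and> x \<noteq> y")
    case True
    then have r: "0 < dist x y" by simp
    have "(\<Sum>j<N. w j * indicator {..R / 2 ^ j} (dist x y)) \<le> ennreal (2 * (R / dist x y) powr p)" for N
    proof -
      have "(\<Sum>j<N. w j * indicator {..R / 2 ^ j} (dist x y))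
          = (\<Sum>j<N. ennreal (indicator {..R / 2 ^ j} (dist x y) * (2 powr p) ^ j))"
        unfolding w_def by (intro sum.cong) (auto simp: indicator_def)
      also have "\<dots> = ennreal (\<Sum>j<N. indicator {..R / 2 ^ j} (dist x y) * (2 powr p) ^ j)"
        by (intro sum_ennreal) auto
      also have "\<dots> \<le> ennreal (2 * (R / dist x y) powr p)"
        by (intro ennreal_leI sum_dyadic_powr_le r R p)
      finally show ?thesis .
    qed
    then have "(\<Sum>j. w j * indicator {..R / 2 ^ j} (dist x y)) \<le> ennreal (2 * (R / dist x y) powr p)"
      by (intro suminf_le_const) auto
    from mult_right_mono[OF this, of "ennreal \<bar>f x - f y\<bar>"]
    have "(\<Sum>j. w j * indicator {..R / 2 ^ j} (dist x y)) * ennreal \<bar>f x - f y\<bar>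
      \<le> ennreal (2 * (R / dist x y) powr p * \<bar>f x - f y\<bar>)"
      by (simp add: ennreal_mult)
    also have "2 * (R / dist x y) powr p * \<bar>f x - f y\<bar> = 2 * R powr p * (\<bar>f x - f y\<bar> / norm (x - y) powr p)"
      using R r by (simp add: powr_divide dist_norm)
    also have "ennreal \<dots> = ennreal (2 * R powr p) * ennreal (\<bar>f x - f y\<bar> / norm (x - y) powr p)"
      by (intro ennreal_mult) auto
    finally show ?thesis using True by (simp add: mult.assoc[symmetric])
  qed (auto simp: indicator_def)
  have "osc f K R * ennreal (1 / (1 - \<delta>)) \<le> osc f K R * (\<Sum>j. ennreal ((2 powr (\<delta> - 1)) ^ j))"
    by (intro mult_left_mono geom) auto
  also have "\<dots> = (\<Sum>j. ennreal ((2 powr (\<delta> - 1)) ^ j) * osc f K R)"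
    by (subst ennreal_suminf_cmult[symmetric]) (simp only: mult.commute)
  also have "\<dots> \<le> (\<Sum>j. w j * osc f K (R / 2 ^ j))"
    unfolding w mult.assoc by (intro suminf_le mult_left_mono osc_halve_iterate K) auto
  also have "\<dots> = (\<integral>\<^sup>+x. \<integral>\<^sup>+y. (\<Sum>j. w j * (indicator K x * indicator K y * indicator {..R / 2 ^ j} (dist x y) *
      ennreal \<bar>f x - f y\<bar>)) \<partial>lborel \<partial>lborel)"
    unfolding osc_def by (simp add: nn_integral_suminf nn_integral_cmult)
  also have "\<dots> \<le> (\<integral>\<^sup>+x. \<integral>\<^sup>+y. ennreal (2 * R powr p) * (indicator K x * indicator K y *
      ennreal (\<bar>f x - f y\<bar> / norm (x - y) powr p)) \<partial>lborel \<partial>lborel)"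
    by (intro nn_integral_mono pt)
  also have "\<dots> = ennreal (2 * R powr p) * ?I"
    by (simp add: nn_integral_cmult)
  finally have main: "osc f K R * ennreal (1 / (1 - \<delta>)) \<le> ennreal (2 * R powr p) * ?I" .
  have "ennreal (1 - \<delta>) * ennreal (1 / (1 - \<delta>)) = ennreal ((1 - \<delta>) * (1 / (1 - \<delta>)))"
    using \<delta> by (intro ennreal_mult[symmetric]) auto
  also have "\<dots> = 1" using \<delta> by simp
  finally have "osc f K R = osc f K R * (ennreal (1 - \<delta>) * ennreal (1 / (1 - \<delta>)))" by simp
  also have "\<dots> = ennreal (1 - \<delta>) * (osc f K R * ennreal (1 / (1 - \<delta>)))"
    by (simp only: mult.left_commute)
  also have "\<dots> \<le> ennreal (1 - \<delta>) * (ennreal (2 * R powr p) * ?I)"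
    by (intro mult_left_mono main) auto
  also have "\<dots> = ennreal (2 * (1 - \<delta>) * R powr p) * ?I"
  proof -
    have "ennreal (1 - \<delta>) * ennreal (2 * R powr p) = ennreal ((1 - \<delta>) * (2 * R powr p))"
      using \<delta> by (intro ennreal_mult[symmetric]) auto
    also have "(1 - \<delta>) * (2 * R powr p) = 2 * (1 - \<delta>) * R powr p" by simp
    finally show ?thesis by (simp only: mult.assoc[symmetric])
  qed
  finally show ?thesis unfolding L .
qed

section \<open>Maximal dyadic cubes\<close>

lemma mem_cube: "x \<in> cube b s \<longleftrightarrow> (\<forall>i. b $ i \<le> x $ i \<and> x $ i \<le> b $ i + s)"
  by (simp add: cube_def mem_box_cart)

lemma mem_interior_cube: "x \<in> interior (cube b s) \<longleftrightarrow> (\<forall>i. b $ i < x $ i \<and> x $ i < b $ i + s)"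
  by (simp add: cube_def interior_cbox mem_box_cart)

lemma sets_cube [measurable]: "cube b s \<in> sets borel"
  by (simp add: cube_def)

lemma convex_cube: "convex (cube b s)"
  by (simp add: cube_def)

lemma emeasure_cube:
  fixes b :: "real ^ 'n"
  assumes "0 \<le> s"
  shows "emeasure lborel (cube b s) = ennreal (s ^ CARD('n))"
proof -
  have "(\<chi> i. s) \<bullet> k = s" if "k \<in> Basis" for k :: "real ^ 'n"
    using that by (auto simp: Basis_vec_def inner_axis)
  then show ?thesis
    using assms by (simp add: cube_def emeasure_lborel_cbox inner_add_left)
qed

text \<open>Closed dyadic cubes overlap in their faces, so disjointness holds for interiors only.
  For Lebesgue integrals the two are interchangeable because faces are null; for \<mu> they need not
  be.\<close>

lemma AE_interior_cube: "AE x in lborel. x \<in> interior (cube b s) \<longleftrightarrow> x \<in> cube b s"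
proof -
  have "cube b s - interior (cube b s) \<in> null_sets lborel"
    using negligible_frontier_interval[of b "b + (\<chi> i. s)"]
    by (simp add: cube_def interior_cbox negligible_iff_null_sets null_sets_completion_iff)
  then have "AE x in lborel. x \<notin> cube b s - interior (cube b s)"
    by (rule AE_not_in)
  then show ?thesis
    by eventually_elim (use interior_subset[of "cube b s"] in auto)
qed

text \<open>The l1 bound gives the diameter n s instead of sqrt(n) s; this n is the base of the
  power in \<open>c\<^sub>0\<close>.\<close>

lemma dist_cube_le:
  fixes b :: "real ^ 'n"
  assumes "x \<in> cube b s" "y \<in> cube b s"
  shows "dist x y \<le> real CARD('n) * s"
proof -
  have "dist x y \<le> (\<Sum>i\<in>UNIV. \<bar>(x - y) $ i\<bar>)"
    unfolding dist_norm by (rule norm_le_l1_cart)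
  also have "\<dots> \<le> (\<Sum>i\<in>(UNIV :: 'n set). s)"
  proof (rule sum_mono)
    fix i :: 'n
    show "\<bar>(x - y) $ i\<bar> \<le> s"
      using assms[unfolded mem_cube, rule_format, of i] by auto
  qed
  finally show ?thesis by simp
qed

text \<open>Comparing the two extreme corners suffices. The second conclusion turns inclusion of
  point sets into equality of (corner, side) pairs, which maximality is stated in.\<close>

lemma cube_subset_cube_imp:
  assumes "cube b s \<subseteq> cube b' s'" "0 \<le> s"
  shows "s \<le> s'" "s = s' \<Longrightarrow> b = b'"
proof -
  have "b \<in> cube b s" "b + (\<chi> i. s) \<in> cube b s" using assms(2) by (auto simp: mem_cube)
  with assms(1) have "b \<in> cube b' s'" "b + (\<chi> i. s) \<in> cube b' s'" by auto
  then have *: "b' $ i \<le> b $ i \<and> b $ i + s \<le> b' $ i + s'" for i by (simp add: mem_cube)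
  from *[of undefined] show "s \<le> s'" by linarith
  assume "s = s'"
  then show "b = b'" using * by (auto simp: vec_eq_iff intro: order_antisym)
qed

section \<open>Bisection and dyadic subcubes\<close>

lemma bisect_subset:
  assumes "(b', s') \<in> bisect (b, s)" "0 \<le> s"
  shows "s' = s / 2" "cube b' s' \<subseteq> cube b s"
proof -
  obtain S where S: "b' = b + (\<chi> i. if i \<in> S then s / 2 else 0)" "s' = s / 2"
    using assms(1) by (auto simp: bisect_def)
  then show "s' = s / 2" by simp
  show "cube b' s' \<subseteq> cube b s"
  proof
    fix x assume x: "x \<in> cube b' s'"
    show "x \<in> cube b s"
      unfolding mem_cube
    proof
      fix i
      show "b $ i \<le> x $ i \<and> x $ i \<le> b $ i + s"
        using x[unfolded mem_cube, rule_format, of i] assms(2) by (auto simp: S split: if_splits)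
    qed
  qed
qed

lemma bisect_cover:
  assumes "x \<in> cube b s"
  obtains b' where "(b', s / 2) \<in> bisect (b, s)" "x \<in> cube b' (s / 2)"
proof -
  \<comment> \<open>Points on a midplane go to the upper half; the halves are closed, so the lower
    bound for \<open>x\<close> is then attained.\<close>
  define S where "S = {i. b $ i + s / 2 \<le> x $ i}"
  define b' where "b' = b + (\<chi> i. if i \<in> S then s / 2 else 0)"
  have "(b', s / 2) \<in> bisect (b, s)" by (auto simp: bisect_def b'_def)
  moreover have "x \<in> cube b' (s / 2)"
    using assms unfolding mem_cube b'_def S_def by (auto simp: not_le less_imp_le) (smt (verit) field_sum_of_halves)+
  ultimately show ?thesis by (rule that)
qed

lemma finite_dyadic_level: "finite (dyadic_level k Q)"
  by (induction k) (auto simp: bisect_def)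

lemma countable_dyadic_subcubes: "countable (dyadic_subcubes a l)"
  unfolding dyadic_subcubes_def by (auto intro: countable_finite finite_dyadic_level)

lemma dyadic_level_side:
  "(b, s) \<in> dyadic_level k (a, l) \<Longrightarrow> s = l / 2 ^ k"
  by (auto simp: dyadic_level_eq)

lemma dyadic_level_subset:
  "(b, s) \<in> dyadic_level k (a, l) \<Longrightarrow> 0 \<le> l \<Longrightarrow> cube b s \<subseteq> cube a l"
proof (induction k arbitrary: b s)
  case (Suc k)
  then obtain b' s' where *: "(b', s') \<in> dyadic_level k (a, l)" "(b, s) \<in> bisect (b', s')" by auto
  moreover have "0 \<le> s'" using dyadic_level_side[OF *(1)] Suc.prems by simp
  ultimately show ?case using Suc.IH[OF *(1)] Suc.prems bisect_subset(2)[OF *(2)] by blast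
qed simp

lemma dyadic_subcube:
  assumes "(b, s) \<in> dyadic_subcubes a l" "0 < l"
  shows "0 < s" "cube b s \<subseteq> cube a l"
  using assms dyadic_level_side dyadic_level_subset[of b s _ a l]
  by (fastforce simp: dyadic_subcubes_def)+

lemma dyadic_level_cover:
  assumes "x \<in> cube a l"
  obtains b where "(b, l / 2 ^ k) \<in> dyadic_level k (a, l)" "x \<in> cube b (l / 2 ^ k)"
proof -
  have "\<exists>b. (b, l / 2 ^ k) \<in> dyadic_level k (a, l) \<and> x \<in> cube b (l / 2 ^ k)"
  proof (induction k)
    case (Suc k)
    then obtain b where b: "(b, l / 2 ^ k) \<in> dyadic_level k (a, l)" "x \<in> cube b (l / 2 ^ k)" by blast
    from bisect_cover[OF b(2)] obtain b' where
      "(b', l / 2 ^ k / 2) \<in> bisect (b, l / 2 ^ k)" "x \<in> cube b' (l / 2 ^ k / 2)" .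
    with b(1) show ?case by (auto simp: mult.commute)
  qed (use assms in auto)
  then show ?thesis using that by blast
qed

text \<open>Serves twice: to cover a set inside a slightly larger open set, and to show that open
  level sets are dyadically dense at each of their points.\<close>

lemma dyadic_subcube_in_open:
  fixes x :: "real ^ 'n"
  assumes "x \<in> cube a l" "0 < l" "open U" "x \<in> U"
  obtains b s where "(b, s) \<in> dyadic_subcubes a l" "x \<in> cube b s" "cube b s \<subseteq> U"
proof -
  obtain e where e: "0 < e" "ball x e \<subseteq> U" using assms by (meson open_contains_ball)
  obtain k where k: "real CARD('n) * l / e < 2 ^ k" using real_arch_pow[of 2 "real CARD('n) * l / e"] by auto
  obtain b where b: "(b, l / 2 ^ k) \<in> dyadic_level k (a, l)" "x \<in> cube b (l / 2 ^ k)"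
    using dyadic_level_cover[OF assms(1)] .
  have "cube b (l / 2 ^ k) \<subseteq> ball x e"
  proof
    fix y assume "y \<in> cube b (l / 2 ^ k)"
    from dist_cube_le[OF b(2) this] have "dist x y \<le> real CARD('n) * (l / 2 ^ k)" .
    also have "\<dots> < e" using k e by (simp add: field_simps)
    finally show "y \<in> ball x e" by simp
  qed
  with e b show ?thesis using that[of b "l / 2 ^ k"] by (auto simp: dyadic_subcubes_def)
qed

text \<open>Measured from \<open>a\<close> in units of the smaller side, both cubes have integer
  corners. A common interior point gives strict inequalities between integers, and these sharpen by
  one to the inequalities for inclusion. With closed cubes a shared face would break the
  argument.\<close>

lemma dyadic_level_nested:
  assumes c: "(b, s) \<in> dyadic_level j (a, l)" and c': "(b', s') \<in> dyadic_level k (a, l)"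
    and jk: "j \<le> k" and l: "0 < l"
    and x: "x \<in> interior (cube b s)" "x \<in> interior (cube b' s')"
  shows "cube b' s' \<subseteq> cube b s"
proof -
  define h where "h = l / 2 ^ k"
  \<comment> \<open>The number of level-\<open>k\<close> cubes along one side of a
    level-\<open>j\<close> cube.\<close>
  define p where "p = (2::nat) ^ (k - j)"
  have h: "0 < h" using l by (simp add: h_def)
  have "(2::real) ^ k = 2 ^ j * 2 ^ (k - j)" using jk by (simp flip: power_add)
  then have hj: "l / 2 ^ j = real p * h" by (simp add: h_def p_def)
  obtain m where m: "b = a + (\<chi> i. real (m i) * (real p * h))" "s = real p * h"
    using c unfolding dyadic_level_eq hj by auto
  obtain m' where m': "b' = a + (\<chi> i. real (m' i) * h)" "s' = h"
    using c' unfolding dyadic_level_eq h_def by auto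
  have nest: "m i * p \<le> m' i \<and> m' i + 1 \<le> (m i + 1) * p" for i
  proof -
    from x(1)[unfolded mem_interior_cube, rule_format, of i]
    have 1: "a $ i + real (m i * p) * h < x $ i" "x $ i < a $ i + real ((m i + 1) * p) * h"
      by (auto simp: m algebra_simps)
    from x(2)[unfolded mem_interior_cube, rule_format, of i]
    have 2: "a $ i + real (m' i) * h < x $ i" "x $ i < a $ i + real (m' i + 1) * h"
      by (auto simp: m' algebra_simps)
    have "real (m i * p) * h < real (m' i + 1) * h" "real (m' i) * h < real ((m i + 1) * p) * h"
      using 1 2 by linarith+
    then have "m i * p < m' i + 1" "m' i < (m i + 1) * p"
      using h by (simp_all only: mult_less_cancel_right_pos of_nat_less_iff)
    then show ?thesis by linarith
  qed
  show ?thesis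
  proof
    fix y assume y: "y \<in> cube b' s'"
    show "y \<in> cube b s"
      unfolding mem_cube
    proof
      fix i
      from y[unfolded mem_cube, rule_format, of i]
      have 3: "a $ i + real (m' i) * h \<le> y $ i" "y $ i \<le> a $ i + real (m' i + 1) * h"
        by (auto simp: m' algebra_simps)
      have "real (m i * p) * h \<le> real (m' i) * h" "real (m' i + 1) * h \<le> real ((m i + 1) * p) * h"
        using nest[of i] h by (simp_all only: mult_le_cancel_right_pos of_nat_le_iff)
      with 3 have "a $ i + real (m i * p) * h \<le> y $ i" "y $ i \<le> a $ i + real ((m i + 1) * p) * h"
        by linarith+
      then show "b $ i \<le> y $ i \<and> y $ i \<le> b $ i + s"
        by (auto simp: m algebra_simps)
    qed
  qed
qed

section \<open>Stopping cubes: maximal dyadic subcubes with a property\<close>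

definition maximal_cubes ::
    "real ^ 'n \<Rightarrow> real \<Rightarrow> ((real ^ 'n) \<times> real \<Rightarrow> bool) \<Rightarrow> ((real ^ 'n) \<times> real) set" where
  "maximal_cubes a l P = {c \<in> dyadic_subcubes a l. P c \<and>
     (\<forall>c'\<in>dyadic_subcubes a l. P c' \<and> case_prod cube c \<subseteq> case_prod cube c' \<longrightarrow> c' = c)}"

lemma countable_maximal_cubes: "countable (maximal_cubes a l P)"
  by (rule countable_subset[OF _ countable_dyadic_subcubes]) (auto simp: maximal_cubes_def)

lemma maximal_cubes_dominate:
  assumes c: "c \<in> dyadic_subcubes a l" "P c" and l: "0 < l"
  obtains c' where "c' \<in> maximal_cubes a l P" "case_prod cube c \<subseteq> case_prod cube c'"
proof -
  define A where "A k = {c' \<in> dyadic_level k (a, l). P c' \<and> case_prod cube c \<subseteq> case_prod cube c'}" for k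
  \<comment> \<open>A cube with \<open>P\<close> that contains \<open>c\<close> and has the coarsest
    possible level is maximal: a larger competitor also contains \<open>c\<close>, so its level is
    not coarser, its side not longer, and inclusion forces equality.\<close>
  define k where "k = (LEAST k. A k \<noteq> {})"
  obtain j where "c \<in> dyadic_level j (a, l)" using c by (auto simp: dyadic_subcubes_def)
  with c have "c \<in> A j" by (simp add: A_def)
  then have "\<exists>k. A k \<noteq> {}" by auto
  then have "A k \<noteq> {}" unfolding k_def by (rule LeastI_ex)
  then obtain c' where c': "c' \<in> A k" by auto
  obtain b s where bs: "c' = (b, s)" by force
  have "c'' = c'" if c'': "c'' \<in> dyadic_subcubes a l" "P c''" "case_prod cube c' \<subseteq> case_prod cube c''" for c''
  proof -
    obtain b' s' where bs': "c'' = (b', s')" by force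
    obtain j where j: "c'' \<in> dyadic_level j (a, l)" using c'' by (auto simp: dyadic_subcubes_def)
    then have "c'' \<in> A j" using c'' c' by (auto simp: A_def)
    then have "k \<le> j" unfolding k_def by (auto intro: Least_le)
    have s: "s = l / 2 ^ k" "s' = l / 2 ^ j"
      using c' j by (auto simp: A_def bs bs' dest: dyadic_level_side)
    with \<open>k \<le> j\<close> l have "s' \<le> s" by (auto intro!: divide_left_mono power_increasing)
    moreover have "0 \<le> s" using s l by simp
    ultimately show ?thesis
      using cube_subset_cube_imp[of b s b' s'] c'' bs bs' by auto
  qed
  with c' have "c' \<in> maximal_cubes a l P"
    by (auto simp: maximal_cubes_def A_def dyadic_subcubes_def)
  with c' show ?thesis using that by (auto simp: A_def)
qed

lemma maximal_cubes_disjoint: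
  assumes "0 < l"
  shows "disjoint_family_on (\<lambda>c. interior (case_prod cube c)) (maximal_cubes a l P)"
proof -
  have *: "c = c'" if mem: "c \<in> maximal_cubes a l P" "c' \<in> maximal_cubes a l P"
    and x: "x \<in> interior (case_prod cube c)" "x \<in> interior (case_prod cube c')"
    and lev: "c \<in> dyadic_level j (a, l)" "c' \<in> dyadic_level k (a, l)" "j \<le> k" for c c' x j k
  proof -
    have "case_prod cube c' \<subseteq> case_prod cube c"
      using dyadic_level_nested[of "fst c" "snd c" j a l "fst c'" "snd c'" k x] lev x assms
      by (simp add: case_prod_beta)
    then show ?thesis using mem by (auto simp: maximal_cubes_def)
  qed
  show ?thesis
    unfolding disjoint_family_on_def
  proof (intro ballI impI, rule ccontr)
    fix c c' assume cc: "c \<in> maximal_cubes a l P" "c' \<in> maximal_cubes a l P" "c \<noteq> c'"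
      and ne: "interior (case_prod cube c) \<inter> interior (case_prod cube c') \<noteq> {}"
    then obtain x where x: "x \<in> interior (case_prod cube c)" "x \<in> interior (case_prod cube c')" by auto
    obtain j k where lev: "c \<in> dyadic_level j (a, l)" "c' \<in> dyadic_level k (a, l)"
      using cc by (auto simp: maximal_cubes_def dyadic_subcubes_def)
    show False
      using *[OF cc(1,2) x lev] *[OF cc(2,1) x(2,1) lev(2,1)] cc(3) by (cases "j \<le> k") auto
  qed
qed

text \<open>The parent is strictly larger, so maximality makes it fail \<open>P\<close>. This is
  where upper bounds at stopping cubes come from; the root has no parent and remains as a separate
  case.\<close>

lemma maximal_cubes_parent:
  assumes c: "c \<in> maximal_cubes a l P" and l: "0 < l"
  obtains "c = (a, l)" | c' where "c' \<in> dyadic_subcubes a l" "\<not> P c'" "c \<in> bisect c'"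
proof -
  obtain k where k: "c \<in> dyadic_level k (a, l)" using c by (auto simp: maximal_cubes_def dyadic_subcubes_def)
  show ?thesis
  proof (cases k)
    case 0
    then show ?thesis using k that(1) by simp
  next
    case (Suc j)
    then obtain b s where p: "(b, s) \<in> dyadic_level j (a, l)" "c \<in> bisect (b, s)" using k by auto
    obtain b' s' where bs': "c = (b', s')" by force
    have s: "0 < s" using dyadic_level_side[OF p(1)] l by simp
    have D: "(b, s) \<in> dyadic_subcubes a l" using p(1) by (auto simp: dyadic_subcubes_def)
    have "cube b' s' \<subseteq> cube b s" "s' = s / 2" using bisect_subset[of b' s' b s] p s bs' by auto
    then have "(b, s) \<noteq> c" using s bs' by auto
    then have "\<not> P (b, s)" using c D \<open>cube b' s' \<subseteq> cube b s\<close> bs' by (auto simp: maximal_cubes_def)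
    then show ?thesis using that(2) D p(2) by blast
  qed
qed

text \<open>Countable additivity of the measure with density \<open>h\<close> on the disjoint
  interiors. It is used with \<open>h = 1\<close> to add volumes and with the weighted energy
  density to add local energies.\<close>

lemma sum_maximal_cubes_le:
  fixes h :: "real ^ 'n \<Rightarrow> ennreal"
  assumes [measurable]: "h \<in> borel_measurable borel" and l: "0 < l"
    and U: "\<And>c. c \<in> maximal_cubes a l P \<Longrightarrow> case_prod cube c \<subseteq> U" and [measurable]: "U \<in> sets borel"
  shows "(\<integral>\<^sup>+c. (\<integral>\<^sup>+x. h x * indicator (case_prod cube c) x \<partial>lborel) \<partial>count_space (maximal_cubes a l P))
    \<le> (\<integral>\<^sup>+x. h x * indicator U x \<partial>lborel)"
proof -
  let ?M = "maximal_cubes a l P"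
  have int [measurable]: "interior (case_prod cube c) \<in> sets borel" for c by simp
  have "(\<integral>\<^sup>+x. h x * indicator (case_prod cube c) x \<partial>lborel)
      = emeasure (density lborel h) (interior (case_prod cube c))" for c
  proof -
    have "(\<integral>\<^sup>+x. h x * indicator (case_prod cube c) x \<partial>lborel)
      = (\<integral>\<^sup>+x. h x * indicator (interior (case_prod cube c)) x \<partial>lborel)"
      using AE_interior_cube[of "fst c" "snd c"]
      by (intro nn_integral_cong_AE) (auto simp: case_prod_beta indicator_def)
    then show ?thesis by (simp add: emeasure_density)
  qed
  then have "(\<integral>\<^sup>+c. (\<integral>\<^sup>+x. h x * indicator (case_prod cube c) x \<partial>lborel) \<partial>count_space ?M)
      = (\<integral>\<^sup>+c. emeasure (density lborel h) (interior (case_prod cube c)) \<partial>count_space ?M)"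
    by simp
  also have "\<dots> = emeasure (density lborel h) (\<Union>c\<in>?M. interior (case_prod cube c))"
    by (intro emeasure_UN_countable[symmetric] countable_maximal_cubes maximal_cubes_disjoint l) auto
  also have "\<dots> \<le> emeasure (density lborel h) U"
    using U interior_subset by (intro emeasure_mono) fastforce+
  also have "\<dots> = (\<integral>\<^sup>+x. h x * indicator U x \<partial>lborel)"
    by (simp add: emeasure_density)
  finally show ?thesis .
qed

section \<open>Real powers in the extended reals\<close>

lemma epowr_ennreal: "0 \<le> v \<Longrightarrow> ennreal v epowr p = ennreal (v powr p)"
  by (simp add: ennreal_powr_def)

lemma epowr_mono: "x \<le> y \<Longrightarrow> 0 \<le> p \<Longrightarrow> x epowr p \<le> y epowr p"
  unfolding ennreal_powr_def
  by (auto simp: top_unique enn2real_mono less_top intro!: ennreal_leI powr_mono2)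

lemma measurable_epowr [measurable (raw)]:
  assumes [measurable]: "f \<in> borel_measurable M"
  shows "(\<lambda>x. f x epowr p) \<in> borel_measurable M"
  unfolding ennreal_powr_def by measurable

lemma epowr_mult:
  "0 < c \<Longrightarrow> (ennreal c * x) epowr p = ennreal (c powr p) * x epowr p"
  by (cases x) (auto simp: ennreal_powr_def ennreal_mult_top ennreal_mult[symmetric] powr_mult)

lemma le_nn_integral_count_space:
  assumes "c \<in> A"
  shows "f c \<le> (\<integral>\<^sup>+c. f c \<partial>count_space A)"
proof -
  have "f c = (\<integral>\<^sup>+x. f c * indicator {c} x \<partial>count_space A)"
    using assms by (simp add: nn_integral_cmult_indicator)
  also have "\<dots> \<le> (\<integral>\<^sup>+c. f c \<partial>count_space A)"
    by (intro nn_integral_mono) (auto simp: indicator_def)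
  finally show ?thesis .
qed

text \<open>With g the sum of the p-th powers, each f(c)^p is at most g, and 1/p - 1 \<ge> 0, so
  f(c) = (f(c)^p)^(1/p-1) f(c)^p \<le> g^(1/p-1) f(c)^p. Summing gives at most g^(1/p).\<close>

lemma epowr_sum_le:
  fixes f :: "'a \<Rightarrow> ennreal"
  assumes p: "0 < p" "p \<le> 1"
  shows "(\<integral>\<^sup>+c. f c \<partial>count_space A) epowr p \<le> (\<integral>\<^sup>+c. f c epowr p \<partial>count_space A)"
    (is "?F epowr p \<le> ?G")
proof (cases ?G)
  case (real g)
  have "f c \<le> ennreal (g powr (1 / p - 1)) * f c epowr p" if "c \<in> A" for c
  proof -
    have le: "f c epowr p \<le> ennreal g"
      using le_nn_integral_count_space[OF that, of "\<lambda>c. f c epowr p"] real by simp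
    then obtain v where v: "f c = ennreal v" "0 \<le> v"
      by (cases "f c") (auto simp: ennreal_powr_def top_unique)
    with le have le': "v powr p \<le> g" using real by (simp add: epowr_ennreal)
    have "v \<le> g powr (1 / p - 1) * v powr p"
    proof (cases "v = 0")
      case False
      have "v = (v powr p) powr (1 / p - 1) * v powr p"
        using p v False by (simp add: powr_powr powr_add[symmetric] algebra_simps)
      also have "\<dots> \<le> g powr (1 / p - 1) * v powr p"
        using le' p by (intro mult_right_mono powr_mono2) (auto simp: field_simps)
      finally show ?thesis .
    qed simp
    then show ?thesis using v by (simp add: epowr_ennreal ennreal_mult[symmetric] ennreal_leI)
  qed
  then have "?F \<le> (\<integral>\<^sup>+c. ennreal (g powr (1 / p - 1)) * f c epowr p \<partial>count_space A)"
    by (intro nn_integral_mono) auto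
  also have "\<dots> = ennreal (g powr (1 / p - 1)) * ?G"
    by (intro nn_integral_cmult) auto
  also have "\<dots> = ennreal (g powr (1 / p))"
  proof (cases "g = 0")
    case False
    then have "g powr (1 / p - 1) * g = g powr (1 / p)"
      using real by (simp add: powr_diff)
    then show ?thesis using real by (simp add: ennreal_mult[symmetric])
  qed (use real in simp)
  finally have "?F epowr p \<le> ennreal (g powr (1 / p)) epowr p"
    using p by (intro epowr_mono) auto
  also have "\<dots> = ?G"
    using p real by (simp add: epowr_ennreal powr_powr)
  finally show ?thesis .
qed simp

lemma emeasure_UN_le_count_space:
  assumes I: "countable I" and [measurable]: "\<And>i. i \<in> I \<Longrightarrow> X i \<in> sets M"
  shows "emeasure M (\<Union>i\<in>I. X i) \<le> (\<integral>\<^sup>+i. emeasure M (X i) \<partial>count_space I)"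
proof -
  have [measurable]: "(\<Union>i\<in>I. X i) \<in> sets M" using assms by (intro sets.countable_UN'') auto
  have "emeasure M (\<Union>i\<in>I. X i) = (\<integral>\<^sup>+x. indicator (\<Union>i\<in>I. X i) x \<partial>M)" by simp
  also have "\<dots> \<le> (\<integral>\<^sup>+x. \<integral>\<^sup>+i. indicator (X i) x \<partial>count_space I \<partial>M)"
  proof (intro nn_integral_mono)
    fix x
    show "indicator (\<Union>i\<in>I. X i) x \<le> (\<integral>\<^sup>+i. indicator (X i) x \<partial>count_space I :: ennreal)"
    proof (cases "x \<in> (\<Union>i\<in>I. X i)")
      case True
      then obtain i where "i \<in> I" "x \<in> X i" by auto
      then show ?thesis
        using le_nn_integral_count_space[of i I "\<lambda>i. indicator (X i) x"] by (auto simp: indicator_def)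
    qed simp
  qed
  also have "\<dots> = (\<integral>\<^sup>+i. \<integral>\<^sup>+x. indicator (X i) x \<partial>M \<partial>count_space I)"
    using I by (intro nn_integral_count_space_nn_integral) auto
  also have "\<dots> = (\<integral>\<^sup>+i. emeasure M (X i) \<partial>count_space I)"
    by (intro nn_integral_cong) auto
  finally show ?thesis .
qed

section \<open>Dyadic density points\<close>

text \<open>A weak form of Lebesgue density. Let \<open>N\<close> be the points of \<open>E\<close>
  in the cube that lie in no dense subcube, and cover \<open>N\<close> by maximal dyadic cubes
  inside an open U with |U| < |N| + e. No cube of the cover is dense, so |N| \<le> \<theta> (|N| +
  e), and \<theta> \<le> 1/2 yields |N| \<le> e.\<close>

lemma AE_dense_dyadic_subcube:
  fixes a :: "real ^ 'n"
  assumes E [measurable]: "E \<in> sets borel" and l: "0 < l" and \<theta>: "0 \<le> \<theta>" "\<theta> \<le> 1 / 2"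
  shows "AE x in lborel. x \<in> E \<inter> cube a l \<longrightarrow>
    (\<exists>c\<in>dyadic_subcubes a l. x \<in> case_prod cube c \<and>
       ennreal \<theta> * emeasure lborel (case_prod cube c) < emeasure lborel (E \<inter> case_prod cube c))"
proof -
  define D where "D = {c \<in> dyadic_subcubes a l.
    ennreal \<theta> * emeasure lborel (case_prod cube c) < emeasure lborel (E \<inter> case_prod cube c)}"
  define N where "N = E \<inter> cube a l - (\<Union>c\<in>D. case_prod cube c)"
  have cm [measurable]: "case_prod cube c \<in> sets borel" for c :: "(real ^ 'n) \<times> real"
    by (simp add: case_prod_beta sets_cube)
  have "countable D"
    by (rule countable_subset[OF _ countable_dyadic_subcubes]) (auto simp: D_def)
  then have N [measurable]: "N \<in> sets borel"
    unfolding N_def by (intro sets.Diff sets.Int sets.countable_UN'') (auto intro: cm sets_cube)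
  have "emeasure lborel N \<le> emeasure lborel (cube a l)"
    by (rule emeasure_mono) (auto simp: N_def)
  then have fin: "emeasure lborel N < \<infinity>"
    using l by (auto simp: emeasure_cube intro: le_less_trans)
  define v where "v = measure lborel N"
  have v: "emeasure lborel N = ennreal v" "0 \<le> v"
    using fin by (auto simp: v_def emeasure_eq_ennreal_measure)
  have "v \<le> 0 + e" if e: "0 < e" for e
  proof -
    obtain U where U: "open U" "N \<subseteq> U" "emeasure lborel (U - N) < ennreal e"
      using outer_regular_lborel[OF N e] .
    then have [measurable]: "U \<in> sets borel" by auto
    \<comment> \<open>A cube that meets \<open>N\<close> cannot belong to \<open>D\<close>, because
      \<open>N\<close> avoids every cube of \<open>D\<close>.\<close>
    define P where "P c \<longleftrightarrow> case_prod cube c \<subseteq> U \<and> case_prod cube c \<inter> N \<noteq> {}" for c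
    let ?M = "maximal_cubes a l P"
    have cov: "N \<subseteq> (\<Union>c\<in>?M. N \<inter> case_prod cube c)"
    proof
      fix x assume x: "x \<in> N"
      then have "x \<in> cube a l" "x \<in> U" using U by (auto simp: N_def)
      then obtain b s where bs: "(b, s) \<in> dyadic_subcubes a l" "x \<in> cube b s" "cube b s \<subseteq> U"
        using dyadic_subcube_in_open l U(1) by metis
      then have "P (b, s)" using x by (auto simp: P_def)
      then obtain c' where "c' \<in> ?M" "cube b s \<subseteq> case_prod cube c'"
        using maximal_cubes_dominate[OF bs(1), of P] l by auto
      then show "x \<in> (\<Union>c\<in>?M. N \<inter> case_prod cube c)" using bs x by (intro UN_I[of c']) auto
    qed
    have "emeasure lborel N \<le> emeasure lborel (\<Union>c\<in>?M. N \<inter> case_prod cube c)"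
      using cov by (intro emeasure_mono sets.countable_UN'' countable_maximal_cubes) (auto intro: cm)
    also have "\<dots> \<le> (\<integral>\<^sup>+c. emeasure lborel (N \<inter> case_prod cube c) \<partial>count_space ?M)"
      by (intro emeasure_UN_le_count_space countable_maximal_cubes) auto
    also have "\<dots> \<le> (\<integral>\<^sup>+c. ennreal \<theta> * emeasure lborel (case_prod cube c) \<partial>count_space ?M)"
    proof (intro nn_integral_mono)
      fix c assume "c \<in> space (count_space ?M)"
      then have c: "c \<in> dyadic_subcubes a l" "case_prod cube c \<inter> N \<noteq> {}"
        by (auto simp: maximal_cubes_def P_def)
      then have "c \<notin> D" by (auto simp: N_def)
      have "emeasure lborel (N \<inter> case_prod cube c) \<le> emeasure lborel (E \<inter> case_prod cube c)"
        by (rule emeasure_mono) (auto simp: N_def)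
      also have "\<dots> \<le> ennreal \<theta> * emeasure lborel (case_prod cube c)"
        using \<open>c \<notin> D\<close> c by (auto simp: D_def not_less)
      finally show "emeasure lborel (N \<inter> case_prod cube c) \<le> ennreal \<theta> * emeasure lborel (case_prod cube c)" .
    qed
    also have "\<dots> = ennreal \<theta> * (\<integral>\<^sup>+c. (\<integral>\<^sup>+x. 1 * indicator (case_prod cube c) x \<partial>lborel) \<partial>count_space ?M)"
      by (simp add: nn_integral_cmult)
    also have "\<dots> \<le> ennreal \<theta> * (\<integral>\<^sup>+x. 1 * indicator U x \<partial>lborel)"
      using l by (intro mult_left_mono sum_maximal_cubes_le) (auto simp: maximal_cubes_def P_def)
    also have "\<dots> = ennreal \<theta> * emeasure lborel U" by simp
    also have "emeasure lborel U = emeasure lborel N + emeasure lborel (U - N)"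
      using U(2) by (subst plus_emeasure) (auto intro!: arg_cong2[where f = emeasure])
    also have "ennreal \<theta> * \<dots> \<le> ennreal \<theta> * (ennreal v + ennreal e)"
      using U(3) v by (intro mult_left_mono add_mono) auto
    also have "\<dots> = ennreal (\<theta> * (v + e))"
      using v \<theta> e by (simp add: ennreal_mult ennreal_plus)
    finally have "v \<le> \<theta> * (v + e)" using v \<theta> e by (simp add: ennreal_le_iff)
    also have "\<dots> \<le> 1 / 2 * (v + e)" using \<theta> v e by (intro mult_right_mono) auto
    finally show ?thesis by simp
  qed
  then have "v \<le> 0" by (rule field_le_epsilon)
  with v have "N \<in> null_sets lborel" by (auto simp: null_sets_def)
  then have "AE x in lborel. x \<notin> N" by (rule AE_not_in)
  then show ?thesis
    by eventually_elim (auto simp: N_def D_def)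
qed

section \<open>The weighted inequality for sets\<close>

text \<open>The inner integral of the Gagliardo energy on \<open>K\<close>. On the diagonal the
  quotient is 0 / 0 = 0.\<close>

definition frac_density :: "real \<Rightarrow> (real ^ 'n \<Rightarrow> real) \<Rightarrow> (real ^ 'n) set \<Rightarrow> real ^ 'n \<Rightarrow> ennreal" where
  "frac_density \<delta> f K x = (\<integral>\<^sup>+y. indicator K y *
     ennreal (\<bar>f x - f y\<bar> / norm (x - y) powr (real CARD('n) + \<delta>)) \<partial>lborel)"

lemma measurable_frac_density [measurable]:
  assumes [measurable]: "f \<in> borel_measurable borel" "K \<in> sets borel"
  shows "frac_density \<delta> f K \<in> borel_measurable borel"
  unfolding frac_density_def by measurable

lemma frac_density_mono: "K \<subseteq> K' \<Longrightarrow> frac_density \<delta> f K x \<le> frac_density \<delta> f K' x"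
  unfolding frac_density_def by (intro nn_integral_mono mult_right_mono) (auto simp: indicator_def)

lemma ennreal_mult3:
  "0 \<le> x \<Longrightarrow> 0 \<le> y \<Longrightarrow> 0 \<le> z \<Longrightarrow> ennreal x * (ennreal y * ennreal z) = ennreal (x * y * z)"
  by (simp add: ennreal_mult mult.assoc)

text \<open>The fractional inequality for the indicator of \<open>E\<close>, with the cube's
  diameter bounded by n s. Multiplying the two measures, and not taking their minimum, lets the
  double integral appear directly.\<close>

lemma relative_isoperimetric:
  fixes b :: "real ^ 'n"
  assumes E [measurable]: "E \<in> sets borel" and s: "0 < s" and \<delta>: "0 \<le> \<delta>" "\<delta> < 1"
  shows "emeasure lborel (E \<inter> cube b s) * emeasure lborel (cube b s - E)
    \<le> ennreal (2 * real CARD('n) ^ (CARD('n) + 1) * (1 - \<delta>) * s powr (real CARD('n) + \<delta>)) *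
      (\<integral>\<^sup>+x. indicator (cube b s) x * frac_density \<delta> (indicator E) (cube b s) x \<partial>lborel)"
    (is "_ \<le> _ * ?J")
proof -
  let ?n = "real CARD('n)" and ?f = "indicator E :: _ \<Rightarrow> real"
  have n: "1 \<le> ?n" by simp
  have [measurable]: "cube b s \<in> sets borel" by (rule sets_cube)
  have "emeasure lborel (E \<inter> cube b s) * emeasure lborel (cube b s - E)
      = (\<integral>\<^sup>+x. indicator (E \<inter> cube b s) x * emeasure lborel (cube b s - E) \<partial>lborel)"
    by (simp add: nn_integral_multc)
  also have "\<dots> = (\<integral>\<^sup>+x. \<integral>\<^sup>+y. indicator (E \<inter> cube b s) x * indicator (cube b s - E) y \<partial>lborel \<partial>lborel)"
    by (simp add: nn_integral_cmult)
  \<comment> \<open>The difference of the indicators is 1 on the product of \<open>E\<close> and its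
    complement in the cube, and also on the mirror image of this product, which is
    discarded.\<close>
  also have "\<dots> \<le> (\<integral>\<^sup>+x. \<integral>\<^sup>+y. indicator (cube b s) x * indicator (cube b s) y * ennreal \<bar>?f x - ?f y\<bar>
      \<partial>lborel \<partial>lborel)"
    by (intro nn_integral_mono) (auto simp: indicator_def)
  also have "\<dots> \<le> ennreal (2 * (1 - \<delta>) * (?n * s) powr (real DIM(real ^ 'n) + \<delta>)) *
      (\<integral>\<^sup>+x. \<integral>\<^sup>+y. indicator (cube b s) x * indicator (cube b s) y *
        ennreal (\<bar>?f x - ?f y\<bar> / norm (x - y) powr (real DIM(real ^ 'n) + \<delta>)) \<partial>lborel \<partial>lborel)"
    using s \<delta> by (intro osc_le_fractional_energy convex_cube dist_cube_le) auto
  also have "(\<integral>\<^sup>+x. \<integral>\<^sup>+y. indicator (cube b s) x * indicator (cube b s) y *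
        ennreal (\<bar>?f x - ?f y\<bar> / norm (x - y) powr (real DIM(real ^ 'n) + \<delta>)) \<partial>lborel \<partial>lborel) = ?J"
    by (simp add: frac_density_def mult.assoc nn_integral_cmult)
  also have "ennreal (2 * (1 - \<delta>) * (?n * s) powr (real DIM(real ^ 'n) + \<delta>)) * ?J
      \<le> ennreal (2 * ?n ^ (CARD('n) + 1) * (1 - \<delta>) * s powr (?n + \<delta>)) * ?J"
  proof (intro mult_right_mono ennreal_leI)
    \<comment> \<open>Raising the exponent to n + 1 removes \<delta> from the constant.\<close>
    have "?n powr (?n + \<delta>) \<le> ?n powr real (CARD('n) + 1)"
      using n \<delta> by (intro powr_mono) auto
    also have "\<dots> = ?n ^ (CARD('n) + 1)" using n by (intro powr_realpow) auto
    finally have "(?n * s) powr (?n + \<delta>) \<le> ?n ^ (CARD('n) + 1) * s powr (?n + \<delta>)"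
      using s by (simp add: powr_mult mult_right_mono)
    from mult_left_mono[OF this, of "2 * (1 - \<delta>)"] \<delta>
    have "2 * (1 - \<delta>) * (?n * s) powr (?n + \<delta>) \<le> 2 * ?n ^ (CARD('n) + 1) * (1 - \<delta>) * s powr (?n + \<delta>)"
      by (simp only: mult_ac) simp
    then show "2 * (1 - \<delta>) * (?n * s) powr (real DIM(real ^ 'n) + \<delta>)
      \<le> 2 * ?n ^ (CARD('n) + 1) * (1 - \<delta>) * s powr (?n + \<delta>)"
      by (simp only: DIM_cart DIM_real mult_1_right)
  qed simp
  finally show ?thesis .
qed

section \<open>The maximal function as a weight\<close>

locale weighted_cube =
  fixes \<delta> q \<alpha> :: real and \<mu> :: "(real ^ 'n) measure" and a :: "real ^ 'n" and l c\<^sub>0 :: real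
  assumes \<delta>: "0 \<le> \<delta>" "\<delta> < 1" and q: "1 \<le> q"
    and \<alpha>: "\<alpha> = real CARD('n) - q * (real CARD('n) - \<delta>)"
    and l: "0 < l"
    and sets_\<mu>: "sets \<mu> = sets borel"
    and fin: "emeasure \<mu> (cube a l) < top"
    and c\<^sub>0: "c\<^sub>0 = 2 * real CARD('n) ^ (CARD('n) + 1)"
begin

lemma sets_\<mu>' [measurable_cong]: "sets \<mu> = sets borel" by (rule sets_\<mu>)

definition W :: "real ^ 'n \<Rightarrow> ennreal" where
  "W x = dyadic_frac_maximal \<alpha> a l \<mu> x epowr (1 / q)"

definition energy :: "(real ^ 'n \<Rightarrow> real) \<Rightarrow> ennreal" where
  "energy f = (\<integral>\<^sup>+x. indicator (cube a l) x * frac_density \<delta> f (cube a l) x * W x \<partial>lborel)"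

text \<open>The index set of the supremum depends on \<open>x\<close>. Multiplying by indicators
  makes it one fixed countable family; cubes that miss \<open>x\<close> then contribute 0, which
  does not affect a supremum in \<open>ennreal\<close>.\<close>

lemma measurable_W [measurable]: "W \<in> borel_measurable borel"
proof -
  have "dyadic_frac_maximal \<alpha> a l \<mu> x = (SUP c\<in>dyadic_subcubes a l.
      ennreal (snd c powr \<alpha>) * (emeasure \<mu> (case_prod cube c) / emeasure lebesgue (case_prod cube c)) *
      indicator (case_prod cube c) x)" (is "?L = ?R") for x
  proof (rule antisym)
    show "?L \<le> ?R"
      unfolding dyadic_frac_maximal_def
    proof (intro SUP_least)
      fix c assume "c \<in> {(b, s). (b, s) \<in> dyadic_subcubes a l \<and> x \<in> cube b s}"
      then show "(case c of (b, s) \<Rightarrow> ennreal (s powr \<alpha>) * (emeasure \<mu> (cube b s) / emeasure lebesgue (cube b s))) \<le> ?R"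
        by (intro SUP_upper2[of c]) (auto simp: case_prod_beta)
    qed
    show "?R \<le> ?L"
    proof (intro SUP_least)
      fix c assume c: "c \<in> dyadic_subcubes a l"
      show "ennreal (snd c powr \<alpha>) * (emeasure \<mu> (case_prod cube c) / emeasure lebesgue (case_prod cube c)) *
        indicator (case_prod cube c) x \<le> ?L"
      proof (cases "x \<in> case_prod cube c")
        case True
        then show ?thesis
          using c unfolding dyadic_frac_maximal_def by (intro SUP_upper2[of c]) (auto simp: case_prod_beta)
      qed simp
    qed
  qed
  moreover have [measurable]: "case_prod cube c \<in> sets borel" for c :: "(real ^ 'n) \<times> real"
    by (simp add: case_prod_beta sets_cube)
  ultimately show ?thesis
    unfolding W_def by (simp, intro measurable_epowr borel_measurable_SUP countable_dyadic_subcubes) measurable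
qed

lemma finite_subcube:
  assumes "(b, s) \<in> dyadic_subcubes a l"
  shows "emeasure \<mu> (cube b s) < top"
proof -
  have "emeasure \<mu> (cube b s) \<le> emeasure \<mu> (cube a l)"
    using dyadic_subcube(2)[OF assms l] by (intro emeasure_mono) (auto simp: sets_\<mu> sets_cube)
  with fin show ?thesis by (rule le_less_trans[rotated])
qed

text \<open>The cube itself competes in the supremum at each of its points. The identity (\<alpha> -
  n) / q = \<delta> - n then leaves a power of the side in which neither \<open>q\<close> nor
  \<open>\<alpha>\<close> occurs.\<close>

lemma W_ge:
  assumes bs: "(b, s) \<in> dyadic_subcubes a l" and x: "x \<in> cube b s"
  shows "emeasure \<mu> (cube b s) epowr (1 / q) * ennreal (s powr (\<delta> - real CARD('n))) \<le> W x"
proof -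
  let ?n = "real CARD('n)"
  have s: "0 < s" using dyadic_subcube(1)[OF bs l] .
  obtain v where v: "emeasure \<mu> (cube b s) = ennreal v" "0 \<le> v"
    using finite_subcube[OF bs] by (cases "emeasure \<mu> (cube b s)") auto
  have "ennreal (s powr \<alpha> * (v / s ^ CARD('n)))
      = ennreal (s powr \<alpha>) * (emeasure \<mu> (cube b s) / emeasure lebesgue (cube b s))"
    using s v by (subst ennreal_mult) (simp_all add: emeasure_cube divide_ennreal)
  also have "\<dots> \<le> dyadic_frac_maximal \<alpha> a l \<mu> x"
    unfolding dyadic_frac_maximal_def using bs x by (intro SUP_upper2[of "(b, s)"]) auto
  finally have "ennreal (s powr \<alpha> * (v / s ^ CARD('n))) epowr (1 / q) \<le> W x"
    unfolding W_def using q by (intro epowr_mono) auto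
  also have "ennreal (s powr \<alpha> * (v / s ^ CARD('n))) epowr (1 / q)
      = ennreal ((s powr \<alpha> * (v / s ^ CARD('n))) powr (1 / q))"
    using s v by (intro epowr_ennreal) auto
  also have "(s powr \<alpha> * (v / s ^ CARD('n))) powr (1 / q) = v powr (1 / q) * s powr (\<delta> - ?n)"
  proof -
    have "s powr \<alpha> * (v / s ^ CARD('n)) = v * s powr (\<alpha> - ?n)"
      using s by (simp add: powr_diff powr_realpow)
    then have "(s powr \<alpha> * (v / s ^ CARD('n))) powr (1 / q) = v powr (1 / q) * s powr ((\<alpha> - ?n) * (1 / q))"
      using s v by (simp add: powr_mult powr_powr)
    also have "(\<alpha> - ?n) * (1 / q) = \<delta> - ?n" using q by (simp add: \<alpha> field_simps)
    finally show ?thesis .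
  qed
  finally show ?thesis using v by (simp add: epowr_ennreal ennreal_mult)
qed

text \<open>The lower bound for \<open>W\<close> is constant on the subcube and can be pulled under
  the integral. Enlarging the \<open>y\<close>-domain to the whole cube leaves only \<open>x\<close>
  restricted, and such terms add up over non-overlapping subcubes.\<close>

lemma W_energy_ge:
  assumes bs: "(b, s) \<in> dyadic_subcubes a l" and [measurable]: "f \<in> borel_measurable borel"
  shows "emeasure \<mu> (cube b s) epowr (1 / q) * ennreal (s powr (\<delta> - real CARD('n))) *
      (\<integral>\<^sup>+x. indicator (cube b s) x * frac_density \<delta> f (cube b s) x \<partial>lborel)
    \<le> (\<integral>\<^sup>+x. frac_density \<delta> f (cube a l) x * W x * indicator (cube b s) x \<partial>lborel)"
    (is "?w * _ \<le> _")
proof -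
  have [measurable]: "cube b s \<in> sets borel" by (rule sets_cube)
  have "?w * (\<integral>\<^sup>+x. indicator (cube b s) x * frac_density \<delta> f (cube b s) x \<partial>lborel)
      = (\<integral>\<^sup>+x. ?w * (indicator (cube b s) x * frac_density \<delta> f (cube b s) x) \<partial>lborel)"
    by (intro nn_integral_cmult[symmetric]) measurable
  also have "\<dots> \<le> (\<integral>\<^sup>+x. frac_density \<delta> f (cube a l) x * W x * indicator (cube b s) x \<partial>lborel)"
  proof (intro nn_integral_mono)
    fix x
    show "?w * (indicator (cube b s) x * frac_density \<delta> f (cube b s) x)
      \<le> frac_density \<delta> f (cube a l) x * W x * indicator (cube b s) x"
    proof (cases "x \<in> cube b s")
      case True
      have "?w * frac_density \<delta> f (cube b s) x \<le> W x * frac_density \<delta> f (cube a l) x"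
        by (intro mult_mono W_ge[OF bs True] frac_density_mono dyadic_subcube[OF bs l]) auto
      then show ?thesis using True by (simp add: mult.commute)
    qed simp
  qed
  finally show ?thesis .
qed

text \<open>At the stopping cubes both \<open>E\<close> and its complement have density bounded below, so there the
  relative isoperimetric inequality is scale invariant.\<close>

lemma powr_le_energy:
  assumes bs: "(b, s) \<in> dyadic_subcubes a l" and [measurable]: "E \<in> sets borel"
    and lo: "ennreal (c * s ^ CARD('n)) \<le> emeasure lborel (E \<inter> cube b s)" "0 < c"
    and hi: "emeasure lborel (E \<inter> cube b s) \<le> ennreal (s ^ CARD('n) / 2)"
  shows "emeasure \<mu> (cube b s) epowr (1 / q)
    \<le> ennreal (2 / c * c\<^sub>0 * (1 - \<delta>)) *
      (\<integral>\<^sup>+x. frac_density \<delta> (indicator E) (cube a l) x * W x * indicator (cube b s) x \<partial>lborel)"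
proof -
  let ?n = "real CARD('n)"
  let ?J = "\<integral>\<^sup>+x. indicator (cube b s) x * frac_density \<delta> (indicator E) (cube b s) x \<partial>lborel"
  have [measurable]: "cube b s \<in> sets borel" by (rule sets_cube)
  have s: "0 < s" using dyadic_subcube(1)[OF bs l] .
  have "ennreal (s ^ CARD('n) / 2) + ennreal (s ^ CARD('n) / 2) = emeasure lborel (cube b s)"
    using s by (simp add: emeasure_cube flip: ennreal_plus)
  also have "\<dots> \<le> emeasure lborel (E \<inter> cube b s) + emeasure lborel (cube b s - E)"
    by (rule order_trans[OF emeasure_mono emeasure_subadditive]) auto
  also have "\<dots> \<le> ennreal (s ^ CARD('n) / 2) + emeasure lborel (cube b s - E)"
    by (intro add_right_mono hi)
  finally have "ennreal (s ^ CARD('n) / 2) \<le> emeasure lborel (cube b s - E)"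
    by (simp add: ennreal_add_left_cancel_le)
  with lo have "ennreal (c * s ^ CARD('n)) * ennreal (s ^ CARD('n) / 2)
      \<le> emeasure lborel (E \<inter> cube b s) * emeasure lborel (cube b s - E)"
    by (intro mult_mono) auto
  also have "\<dots> \<le> ennreal (c\<^sub>0 * (1 - \<delta>) * s powr (?n + \<delta>)) * ?J"
    unfolding c\<^sub>0 by (intro relative_isoperimetric s \<delta>) auto
  finally have *: "ennreal (c * s ^ CARD('n)) * ennreal (s ^ CARD('n) / 2)
      \<le> ennreal (c\<^sub>0 * (1 - \<delta>) * s powr (?n + \<delta>)) * ?J" .
  \<comment> \<open>The reciprocal of the left side of \<open>*\<close>. On the right, s^(-2n)
    s^(n+\<delta>) = s^(\<delta>-n) is exactly the factor in \<open>W_energy_ge\<close>.\<close>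
  define k where "k = 2 / c * s powr (- 2 * ?n)"
  have k: "0 \<le> k" using lo by (simp add: k_def)
  have 1: "k * (c * s ^ CARD('n)) * (s ^ CARD('n) / 2) = 1"
  proof -
    have "k * (c * s ^ CARD('n)) * (s ^ CARD('n) / 2) = s powr (- 2 * ?n) * (s ^ CARD('n) * s ^ CARD('n))"
      using lo by (simp add: k_def)
    also have "\<dots> = 1" using s by (simp add: powr_realpow[symmetric] powr_add[symmetric])
    finally show ?thesis .
  qed
  have 2: "k * (c\<^sub>0 * (1 - \<delta>) * s powr (?n + \<delta>)) = 2 / c * c\<^sub>0 * (1 - \<delta>) * s powr (\<delta> - ?n)"
    by (simp add: k_def powr_add[symmetric])
  have "1 = ennreal k * (ennreal (c * s ^ CARD('n)) * ennreal (s ^ CARD('n) / 2))"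
    using k lo s by (subst ennreal_mult3) (simp_all only: 1, simp_all)
  also have "\<dots> \<le> ennreal k * (ennreal (c\<^sub>0 * (1 - \<delta>) * s powr (?n + \<delta>)) * ?J)"
    by (intro mult_left_mono *) auto
  also have "\<dots> = ennreal (2 / c * c\<^sub>0 * (1 - \<delta>)) * (ennreal (s powr (\<delta> - ?n)) * ?J)"
  proof -
    have "ennreal k * ennreal (c\<^sub>0 * (1 - \<delta>) * s powr (?n + \<delta>)) = ennreal (k * (c\<^sub>0 * (1 - \<delta>) * s powr (?n + \<delta>)))"
      using k \<delta> by (intro ennreal_mult[symmetric]) (auto simp: c\<^sub>0)
    also have "\<dots> = ennreal (2 / c * c\<^sub>0 * (1 - \<delta>)) * ennreal (s powr (\<delta> - ?n))"
      unfolding 2 using \<delta> lo by (intro ennreal_mult) (auto simp: c\<^sub>0)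
    finally show ?thesis by (simp only: mult.assoc[symmetric])
  qed
  finally have "emeasure \<mu> (cube b s) epowr (1 / q) * 1 \<le> emeasure \<mu> (cube b s) epowr (1 / q) *
      (ennreal (2 / c * c\<^sub>0 * (1 - \<delta>)) * (ennreal (s powr (\<delta> - ?n)) * ?J))"
    by (intro mult_left_mono) auto
  also have "\<dots> = ennreal (2 / c * c\<^sub>0 * (1 - \<delta>)) *
      (emeasure \<mu> (cube b s) epowr (1 / q) * ennreal (s powr (\<delta> - ?n)) * ?J)"
    by (simp only: mult_ac)
  also have "\<dots> \<le> ennreal (2 / c * c\<^sub>0 * (1 - \<delta>)) *
      (\<integral>\<^sup>+x. frac_density \<delta> (indicator E) (cube a l) x * W x * indicator (cube b s) x \<partial>lborel)"
    by (intro mult_left_mono W_energy_ge bs) auto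
  finally show ?thesis by simp
qed

text \<open>The threshold combines the factor 1/2 with the volume ratio 2^(-n) of child to parent,
  so that failure at a parent means density at most 1/2 in each child.\<close>

definition dyadically_dense :: "(real ^ 'n) set \<Rightarrow> real ^ 'n \<Rightarrow> bool" where
  "dyadically_dense E x \<longleftrightarrow> (\<exists>c\<in>dyadic_subcubes a l. x \<in> case_prod cube c \<and>
     ennreal (1 / 2 ^ (CARD('n) + 1)) * emeasure lborel (case_prod cube c)
       < emeasure lborel (E \<inter> case_prod cube c))"

lemma root_in_dyadic_subcubes: "(a, l) \<in> dyadic_subcubes a l"
  by (auto simp: dyadic_subcubes_def intro: exI[of _ 0])

lemma c\<^sub>0_pos: "0 < c\<^sub>0"
  by (simp add: c\<^sub>0)

lemma set_measure_le_energy: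
  assumes [measurable]: "E \<in> sets borel"
    and half: "emeasure lborel (E \<inter> cube a l) \<le> ennreal (l ^ CARD('n) / 2)"
    and dense: "AE x in \<mu>. x \<in> E \<inter> cube a l \<longrightarrow> dyadically_dense E x"
  shows "emeasure \<mu> (E \<inter> cube a l) epowr (1 / q)
    \<le> ennreal (2 * 2 ^ (CARD('n) + 1) * c\<^sub>0 * (1 - \<delta>)) * energy (indicator E)"
proof -
  define \<theta> :: real where "\<theta> = 1 / 2 ^ (CARD('n) + 1)"
  have \<theta>: "0 < \<theta>" "2 / \<theta> = 2 * 2 ^ (CARD('n) + 1)" by (simp_all add: \<theta>_def)
  define P where "P c \<longleftrightarrow> ennreal \<theta> * emeasure lborel (case_prod cube c)
    < emeasure lborel (E \<inter> case_prod cube c)" for c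
  let ?M = "maximal_cubes a l P" and ?k = "ennreal (2 / \<theta> * c\<^sub>0 * (1 - \<delta>))"
  let ?h = "\<lambda>x. frac_density \<delta> (indicator E) (cube a l) x * W x"
  have cm [measurable]: "case_prod cube c \<in> sets borel" for c :: "(real ^ 'n) \<times> real"
    by (simp add: case_prod_beta sets_cube)
  have cover: "x \<in> (\<Union>c\<in>?M. case_prod cube c)" if dd: "dyadically_dense E x" for x
  proof -
    obtain c where c: "c \<in> dyadic_subcubes a l" "x \<in> case_prod cube c" "P c"
      using dd unfolding dyadically_dense_def P_def \<theta>_def by blast
    obtain c' where "c' \<in> ?M" "case_prod cube c \<subseteq> case_prod cube c'"
      using maximal_cubes_dominate[where P = P, OF c(1,3) l] .
    then show ?thesis using c by (intro UN_I[of c']) auto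
  qed
  have "emeasure \<mu> (E \<inter> cube a l) \<le> emeasure \<mu> (\<Union>c\<in>?M. case_prod cube c)"
  proof (rule emeasure_mono_AE)
    show "AE x in \<mu>. x \<in> E \<inter> cube a l \<longrightarrow> x \<in> (\<Union>c\<in>?M. case_prod cube c)"
      using dense by eventually_elim (use cover in blast)
    show "(\<Union>c\<in>?M. case_prod cube c) \<in> sets \<mu>"
      unfolding sets_\<mu> by (intro sets.countable_UN'' countable_maximal_cubes cm)
  qed
  \<comment> \<open>Subadditivity is the right tool here: the closed cubes share faces, which \<mu>
    may charge.\<close>
  also have "\<dots> \<le> (\<integral>\<^sup>+c. emeasure \<mu> (case_prod cube c) \<partial>count_space ?M)"
    by (intro emeasure_UN_le_count_space countable_maximal_cubes) (simp add: sets_\<mu> cm)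
  finally have "emeasure \<mu> (E \<inter> cube a l) epowr (1 / q)
      \<le> (\<integral>\<^sup>+c. emeasure \<mu> (case_prod cube c) \<partial>count_space ?M) epowr (1 / q)"
    using q by (intro epowr_mono) auto
  also have "\<dots> \<le> (\<integral>\<^sup>+c. emeasure \<mu> (case_prod cube c) epowr (1 / q) \<partial>count_space ?M)"
    using q by (intro epowr_sum_le) auto
  also have "\<dots> \<le> (\<integral>\<^sup>+c. ?k * (\<integral>\<^sup>+x. ?h x * indicator (case_prod cube c) x \<partial>lborel) \<partial>count_space ?M)"
  proof (intro nn_integral_mono)
    fix c assume "c \<in> space (count_space ?M)"
    then have cM: "c \<in> ?M" by simp
    obtain b s where bs: "c = (b, s)" by force
    have D: "(b, s) \<in> dyadic_subcubes a l" and P: "P (b, s)" using cM bs by (auto simp: maximal_cubes_def)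
    have s: "0 < s" using dyadic_subcube(1)[OF D l] .
    \<comment> \<open>At the root the bound is the hypothesis \<open>half\<close>. Otherwise the
      parent has side 2s and fails \<open>P\<close>, and 2^(-n-1) (2s)^n = s^n / 2.\<close>
    have hi: "emeasure lborel (E \<inter> cube b s) \<le> ennreal (s ^ CARD('n) / 2)"
    proof (rule maximal_cubes_parent[OF cM l])
      assume "c = (a, l)"
      then show ?thesis using half bs by simp
    next
      fix c' assume c': "c' \<in> dyadic_subcubes a l" "\<not> P c'" "c \<in> bisect c'"
      obtain b' s' where bs': "c' = (b', s')" by force
      have s': "0 < s'" using dyadic_subcube(1) c' l bs' by blast
      have sub: "s = s' / 2" "cube b s \<subseteq> cube b' s'"
        using bisect_subset[of b s b' s'] c' s' bs bs' by auto
      have "emeasure lborel (E \<inter> cube b s) \<le> emeasure lborel (E \<inter> cube b' s')"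
        using sub sets_cube[of b' s'] by (intro emeasure_mono) auto
      also have "\<dots> \<le> ennreal \<theta> * emeasure lborel (cube b' s')"
        using c' by (simp add: P_def bs' not_less)
      also have "\<dots> = ennreal (\<theta> * s' ^ CARD('n))"
        using s' \<theta> by (simp add: emeasure_cube ennreal_mult)
      also have "\<theta> * s' ^ CARD('n) = s ^ CARD('n) / 2"
        by (simp add: \<theta>_def sub power_divide)
      finally show ?thesis .
    qed
    have lo: "ennreal (\<theta> * s ^ CARD('n)) \<le> emeasure lborel (E \<inter> cube b s)"
      using P s \<theta> by (simp add: P_def emeasure_cube ennreal_mult less_imp_le)
    show "emeasure \<mu> (case_prod cube c) epowr (1 / q)
        \<le> ?k * (\<integral>\<^sup>+x. ?h x * indicator (case_prod cube c) x \<partial>lborel)"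
      using powr_le_energy[OF D _ lo \<theta>(1) hi] by (simp add: bs)
  qed
  also have "\<dots> = ?k * (\<integral>\<^sup>+c. (\<integral>\<^sup>+x. ?h x * indicator (case_prod cube c) x \<partial>lborel) \<partial>count_space ?M)"
    by (intro nn_integral_cmult) auto
  also have "\<dots> \<le> ?k * (\<integral>\<^sup>+x. ?h x * indicator (cube a l) x \<partial>lborel)"
    using dyadic_subcube(2)[OF _ l]
    by (intro mult_left_mono sum_maximal_cubes_le l sets_cube) (auto simp: maximal_cubes_def)
  also have "(\<integral>\<^sup>+x. ?h x * indicator (cube a l) x \<partial>lborel) = energy (indicator E)"
    unfolding energy_def by (intro nn_integral_cong) (simp add: mult_ac)
  finally show ?thesis by (simp only: \<theta>(2))
qed

text \<open>Needed for the distance between median and mean. The left side keeps the factor |E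
  \<inter> Q|, so no lower density bound for \<open>E\<close>, and hence no stopping cube, is
  required: the isoperimetric inequality on Q suffices, the complement filling at least half of
  Q.\<close>

lemma set_average_le_energy:
  assumes [measurable]: "E \<in> sets borel"
    and half: "emeasure lborel (E \<inter> cube a l) \<le> ennreal (l ^ CARD('n) / 2)"
  shows "emeasure lborel (E \<inter> cube a l) * emeasure \<mu> (cube a l) epowr (1 / q)
    \<le> ennreal (2 * c\<^sub>0 * (1 - \<delta>) * l ^ CARD('n)) * energy (indicator E)"
proof -
  let ?n = "real CARD('n)"
  let ?J = "\<integral>\<^sup>+x. indicator (cube a l) x * frac_density \<delta> (indicator E) (cube a l) x \<partial>lborel"
  let ?m = "emeasure \<mu> (cube a l) epowr (1 / q)" and ?e = "emeasure lborel (E \<inter> cube a l)"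
  have [measurable]: "cube a l \<in> sets borel" by (rule sets_cube)
  have co: "ennreal (l ^ CARD('n) / 2) \<le> emeasure lborel (cube a l - E)"
  proof -
    have "ennreal (l ^ CARD('n) / 2) + ennreal (l ^ CARD('n) / 2) = emeasure lborel (cube a l)"
      using l by (simp add: emeasure_cube flip: ennreal_plus)
    also have "\<dots> \<le> ?e + emeasure lborel (cube a l - E)"
      by (rule order_trans[OF emeasure_mono emeasure_subadditive]) auto
    also have "\<dots> \<le> ennreal (l ^ CARD('n) / 2) + emeasure lborel (cube a l - E)"
      by (intro add_right_mono half)
    finally show ?thesis by (simp add: ennreal_add_left_cancel_le)
  qed
  have "?e * ennreal (l ^ CARD('n) / 2) \<le> ?e * emeasure lborel (cube a l - E)"
    by (intro mult_left_mono co) auto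
  also have "\<dots> \<le> ennreal (c\<^sub>0 * (1 - \<delta>) * l powr (?n + \<delta>)) * ?J"
    unfolding c\<^sub>0 by (intro relative_isoperimetric l \<delta>) auto
  finally have *: "?e * ennreal (l ^ CARD('n) / 2) \<le> ennreal (c\<^sub>0 * (1 - \<delta>) * l powr (?n + \<delta>)) * ?J" .
  define k where "k = 2 * l powr (- ?n)"
  have k: "0 \<le> k" by (simp add: k_def)
  have 1: "ennreal (l ^ CARD('n) / 2) * ennreal k = 1"
  proof -
    have "l ^ CARD('n) / 2 * k = 1" using l by (simp add: k_def powr_minus powr_realpow field_simps)
    then show ?thesis using k l by (subst ennreal_mult[symmetric]) (auto simp del: ennreal_half)
  qed
  have 2: "ennreal (c\<^sub>0 * (1 - \<delta>) * l powr (?n + \<delta>)) * ennreal k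
      = ennreal (2 * c\<^sub>0 * (1 - \<delta>) * l ^ CARD('n)) * ennreal (l powr (\<delta> - ?n))"
  proof -
    have "c\<^sub>0 * (1 - \<delta>) * l powr (?n + \<delta>) * k = 2 * c\<^sub>0 * (1 - \<delta>) * l ^ CARD('n) * l powr (\<delta> - ?n)"
      using l by (simp add: k_def powr_realpow[symmetric] powr_add[symmetric])
    then show ?thesis
      using c\<^sub>0_pos \<delta> k l by (subst (1 2) ennreal_mult[symmetric]) (auto intro!: mult_nonneg_nonneg)
  qed
  have "?e * ?m = ?e * (ennreal (l ^ CARD('n) / 2) * ennreal k) * ?m" by (simp only: 1 mult_1_right)
  also have "\<dots> = (?e * ennreal (l ^ CARD('n) / 2)) * (ennreal k * ?m)" by (simp only: mult.assoc)
  also have "\<dots> \<le> (ennreal (c\<^sub>0 * (1 - \<delta>) * l powr (?n + \<delta>)) * ?J) * (ennreal k * ?m)"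
    by (intro mult_right_mono *) auto
  also have "\<dots> = (ennreal (c\<^sub>0 * (1 - \<delta>) * l powr (?n + \<delta>)) * ennreal k) * (?m * ?J)"
    by (simp only: mult_ac)
  also have "\<dots> = ennreal (2 * c\<^sub>0 * (1 - \<delta>) * l ^ CARD('n)) * (?m * ennreal (l powr (\<delta> - ?n)) * ?J)"
    unfolding 2 by (simp only: mult_ac)
  also have "\<dots> \<le> ennreal (2 * c\<^sub>0 * (1 - \<delta>) * l ^ CARD('n)) *
      (\<integral>\<^sup>+x. frac_density \<delta> (indicator E) (cube a l) x * W x * indicator (cube a l) x \<partial>lborel)"
    by (intro mult_left_mono W_energy_ge root_in_dyadic_subcubes) auto
  also have "(\<integral>\<^sup>+x. frac_density \<delta> (indicator E) (cube a l) x * W x * indicator (cube a l) x \<partial>lborel)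
      = energy (indicator E)"
    unfolding energy_def by (intro nn_integral_cong) (simp add: mult_ac)
  finally show ?thesis .
qed

end

section \<open>Coarea formula\<close>

lemma nn_integral_between:
  fixes u v :: real
  assumes "0 \<le> u" "0 \<le> v" "0 \<le> k"
  shows "(\<integral>\<^sup>+t. indicator {0<..} t * ennreal (\<bar>(if t < u then 1 else 0) - (if t < v then 1 else 0)\<bar> * k) \<partial>lborel)
    = ennreal (\<bar>u - v\<bar> * k)"
proof -
  \<comment> \<open>Exactly one of \<open>t < u\<close>, \<open>t < v\<close> holds on the half-open
    interval. If its left end is 0, the point \<open>t = 0\<close> is excluded on the left side
    only, which a null set absorbs.\<close>
  have "(\<integral>\<^sup>+t. indicator {0<..} t * ennreal (\<bar>(if t < u then 1 else 0) - (if t < v then 1 else 0)\<bar> * k) \<partial>lborel)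
      = (\<integral>\<^sup>+t. ennreal k * indicator {min u v..<max u v} t \<partial>lborel)"
    using assms AE_lborel_singleton[of 0]
    by (intro nn_integral_cong_AE) (auto simp: indicator_def min_def max_def)
  also have "\<dots> = ennreal k * ennreal (\<bar>u - v\<bar>)"
    by (simp add: nn_integral_cmult_indicator abs_real_def max_def min_def)
  also have "\<dots> = ennreal (\<bar>u - v\<bar> * k)"
    using assms by (subst ennreal_mult[symmetric]) (simp_all add: mult.commute)
  finally show ?thesis .
qed

context weighted_cube
begin

lemma measurable_cube [measurable]: "cube a l \<in> sets borel"
  by (rule sets_cube)

lemma energy_indicator_measurable:
  fixes g :: "real ^ 'n \<Rightarrow> real"
  assumes [measurable]: "g \<in> borel_measurable borel"
  shows "(\<lambda>t. energy (indicator {x. t < g x})) \<in> borel_measurable borel"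
proof -
  have ind: "indicator {x. t < g x} = (\<lambda>x. if t < g x then 1 else 0 :: real)" for t
    by (auto simp: indicator_def)
  show ?thesis
    unfolding energy_def frac_density_def ind by measurable
qed

text \<open>|g x - g y| is the integral over t > 0 of the differences of the level-set indicators,
  while kernel and weight do not depend on t. Tonelli then gives equality.\<close>

lemma energy_coarea:
  assumes [measurable]: "g \<in> borel_measurable borel" and g: "\<And>x. 0 \<le> g x"
  shows "(\<integral>\<^sup>+t. indicator {0<..} t * energy (indicator {x. t < g x}) \<partial>lborel) = energy g"
proof -
  define r where "r x y = norm (x - y) powr (real CARD('n) + \<delta>)" for x y :: "real ^ 'n"
  define D where "D t x y = ennreal (\<bar>(if t < g x then 1 else 0) - (if t < g y then 1 else 0)\<bar> * (1 / r x y))"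
    for t x y
  define F where "F t x y = indicator (cube a l) x * W x * indicator (cube a l) y * (indicator {0<..} t * D t x y)"
    for t :: real and x y
  have [measurable]: "(\<lambda>(t, x, y). F t x y) \<in> borel_measurable (lborel \<Otimes>\<^sub>M lborel \<Otimes>\<^sub>M lborel)"
    unfolding F_def D_def r_def by measurable
  have Dy: "D t x \<in> borel_measurable borel" and Dt: "(\<lambda>t. D t x y) \<in> borel_measurable borel" for t x y
    unfolding D_def[abs_def] r_def by measurable
  have ry: "(\<lambda>y. ennreal (\<bar>g x - g y\<bar> / r x y)) \<in> borel_measurable borel" for x
    unfolding r_def by measurable
  have ind: "indicator {x. t < g x} x = (if t < g x then 1 else 0 :: real)" for t x
    by (auto simp: indicator_def)
  have density: "frac_density \<delta> (indicator {x. t < g x}) (cube a l) x = (\<integral>\<^sup>+y. indicator (cube a l) y * D t x y \<partial>lborel)" for t x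
    unfolding frac_density_def ind r_def D_def by simp
  have D: "(\<integral>\<^sup>+t. indicator {0<..} t * D t x y \<partial>lborel) = ennreal (\<bar>g x - g y\<bar> / r x y)" for x y
    unfolding D_def by (subst nn_integral_between) (auto simp: g r_def)
  have Fy: "(\<integral>\<^sup>+y. F t x y \<partial>lborel)
      = indicator {0<..} t * (indicator (cube a l) x * frac_density \<delta> (indicator {x. t < g x}) (cube a l) x * W x)" for t x
  proof -
    have "(\<integral>\<^sup>+y. F t x y \<partial>lborel)
        = (\<integral>\<^sup>+y. (indicator {0<..} t * indicator (cube a l) x * W x) * (indicator (cube a l) y * D t x y) \<partial>lborel)"
      unfolding F_def by (intro nn_integral_cong) (simp only: mult_ac)
    also have "\<dots> = (indicator {0<..} t * indicator (cube a l) x * W x) * (\<integral>\<^sup>+y. indicator (cube a l) y * D t x y \<partial>lborel)"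
      using Dy by (intro nn_integral_cmult borel_measurable_times_ennreal) auto
    finally show ?thesis unfolding density by (simp only: mult_ac)
  qed
  have Ft: "(\<integral>\<^sup>+t. F t x y \<partial>lborel)
      = indicator (cube a l) x * W x * indicator (cube a l) y * ennreal (\<bar>g x - g y\<bar> / r x y)" for x y
    unfolding F_def D[symmetric] using Dt by (intro nn_integral_cmult borel_measurable_times_ennreal) auto
  have "(\<integral>\<^sup>+t. indicator {0<..} t * energy (indicator {x. t < g x}) \<partial>lborel)
      = (\<integral>\<^sup>+t. \<integral>\<^sup>+x. \<integral>\<^sup>+y. F t x y \<partial>lborel \<partial>lborel \<partial>lborel)"
    unfolding Fy energy_def
    by (intro nn_integral_cong nn_integral_cmult[symmetric] borel_measurable_times_ennreal measurable_frac_density) auto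
  also have "\<dots> = (\<integral>\<^sup>+x. \<integral>\<^sup>+t. \<integral>\<^sup>+y. F t x y \<partial>lborel \<partial>lborel \<partial>lborel)"
    by (rule lborel_pair.Fubini') (unfold F_def D_def r_def, measurable)
  also have "\<dots> = (\<integral>\<^sup>+x. \<integral>\<^sup>+y. \<integral>\<^sup>+t. F t x y \<partial>lborel \<partial>lborel \<partial>lborel)"
    by (intro nn_integral_cong lborel_pair.Fubini') (unfold F_def D_def r_def, measurable)
  also have "\<dots> = energy g"
    unfolding energy_def
  proof (intro nn_integral_cong)
    fix x
    have "(\<integral>\<^sup>+y. \<integral>\<^sup>+t. F t x y \<partial>lborel \<partial>lborel)
        = (\<integral>\<^sup>+y. (indicator (cube a l) x * W x) * (indicator (cube a l) y * ennreal (\<bar>g x - g y\<bar> / r x y)) \<partial>lborel)"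
      unfolding Ft by (intro nn_integral_cong) (simp only: mult_ac)
    also have "\<dots> = (indicator (cube a l) x * W x) *
        (\<integral>\<^sup>+y. indicator (cube a l) y * ennreal (\<bar>g x - g y\<bar> / r x y) \<partial>lborel)"
      using ry by (intro nn_integral_cmult borel_measurable_times_ennreal) auto
    also have "\<dots> = (indicator (cube a l) x * W x) * frac_density \<delta> g (cube a l) x"
      unfolding frac_density_def r_def by simp
    finally show "(\<integral>\<^sup>+y. \<integral>\<^sup>+t. F t x y \<partial>lborel \<partial>lborel)
        = indicator (cube a l) x * frac_density \<delta> g (cube a l) x * W x"
      by (simp only: mult_ac)
  qed
  finally show ?thesis .
qed

text \<open>Layer cake on the left, coarea on the right, \<open>set_average_le_energy\<close> at
  each level. The left side is linear in the level sets, so no power has to be distributed over a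
  sum.\<close>

lemma integral_le_energy:
  assumes [measurable]: "g \<in> borel_measurable borel" and g: "\<And>x. 0 \<le> g x"
    and half: "emeasure lborel ({x. 0 < g x} \<inter> cube a l) \<le> ennreal (l ^ CARD('n) / 2)"
  shows "(\<integral>\<^sup>+x. indicator (cube a l) x * ennreal (g x) \<partial>lborel) * emeasure \<mu> (cube a l) epowr (1 / q)
    \<le> ennreal (2 * c\<^sub>0 * (1 - \<delta>) * l ^ CARD('n)) * energy g"
    (is "?L * ?m \<le> ?k * _")
proof -
  have [measurable]: "(\<lambda>(x, t). indicator (cube a l) x * indicator {0<..<g x} t :: ennreal)
      \<in> borel_measurable (lborel \<Otimes>\<^sub>M lborel)"
  proof -
    have "(\<lambda>(x, t). indicator (cube a l) x * indicator {0<..<g x} t :: ennreal)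
      = (\<lambda>(x, t). indicator (cube a l) x * (if 0 < t \<and> t < g x then 1 else 0))"
      by (auto simp: indicator_def)
    then show ?thesis by simp
  qed
  have "?L = (\<integral>\<^sup>+x. \<integral>\<^sup>+t. indicator (cube a l) x * indicator {0<..<g x} t \<partial>lborel \<partial>lborel)"
    using g by (intro nn_integral_cong) (simp add: nn_integral_cmult)
  also have "\<dots> = (\<integral>\<^sup>+t. \<integral>\<^sup>+x. indicator (cube a l) x * indicator {0<..<g x} t \<partial>lborel \<partial>lborel)"
    by (rule lborel_pair.Fubini'[symmetric]) (simp add: case_prod_beta')
  also have "\<dots> = (\<integral>\<^sup>+t. indicator {0<..} t * emeasure lborel ({x. t < g x} \<inter> cube a l) \<partial>lborel)"
  proof (intro nn_integral_cong)
    fix t :: real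
    have "(\<integral>\<^sup>+x. indicator (cube a l) x * indicator {0<..<g x} t \<partial>lborel)
        = (\<integral>\<^sup>+x. indicator {0<..} t * indicator ({x. t < g x} \<inter> cube a l) x \<partial>lborel)"
      by (intro nn_integral_cong) (auto simp: indicator_def)
    also have "\<dots> = indicator {0<..} t * emeasure lborel ({x. t < g x} \<inter> cube a l)"
      by (intro nn_integral_cmult_indicator) measurable
    finally show "(\<integral>\<^sup>+x. indicator (cube a l) x * indicator {0<..<g x} t \<partial>lborel)
        = indicator {0<..} t * emeasure lborel ({x. t < g x} \<inter> cube a l)" .
  qed
  finally have L: "?L = \<dots>" .
  have mt [measurable]: "(\<lambda>t. emeasure lborel ({x. t < g x} \<inter> cube a l)) \<in> borel_measurable borel"
  proof -
    have "(\<lambda>t. emeasure lborel ({x. t < g x} \<inter> cube a l))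
        = (\<lambda>t. \<integral>\<^sup>+x. (if t < g x then 1 else 0) * indicator (cube a l) x \<partial>lborel)"
      by (intro ext, subst nn_integral_indicator[symmetric], measurable, intro nn_integral_cong) (auto simp: indicator_def)
    then show ?thesis by simp
  qed
  have [measurable]: "(\<lambda>t. energy (indicator {x. t < g x})) \<in> borel_measurable borel"
    by (intro energy_indicator_measurable) measurable
  have "?L * ?m = (\<integral>\<^sup>+t. indicator {0<..} t * emeasure lborel ({x. t < g x} \<inter> cube a l) * ?m \<partial>lborel)"
    unfolding L by (intro nn_integral_multc[symmetric]) measurable
  also have "\<dots> \<le> (\<integral>\<^sup>+t. ?k * (indicator {0<..} t * energy (indicator {x. t < g x})) \<partial>lborel)"
  proof (intro nn_integral_mono)
    fix t :: real
    show "indicator {0<..} t * emeasure lborel ({x. t < g x} \<inter> cube a l) * ?m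
      \<le> ?k * (indicator {0<..} t * energy (indicator {x. t < g x}))"
    proof (cases "0 < t")
      case True
      have "emeasure lborel ({x. t < g x} \<inter> cube a l) \<le> emeasure lborel ({x. 0 < g x} \<inter> cube a l)"
        using True by (intro emeasure_mono) auto
      also note half
      finally have "emeasure lborel ({x. t < g x} \<inter> cube a l) * ?m \<le> ?k * energy (indicator {x. t < g x})"
        by (intro set_average_le_energy) measurable
      then show ?thesis using True by simp
    qed simp
  qed
  also have "\<dots> = ?k * energy g"
    by (subst nn_integral_cmult) (measurable, simp only: energy_coarea[OF assms(1) g])
  finally show ?thesis .
qed

text \<open>Only the levels \<open>2\<^sup>k\<close> enter: subadditivity of \<open>t powr (1 / q)\<close> then replaces Minkowski's integral
  inequality, and monotonicity of the level sets compares each term with the coarea integral over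
  \<open>(2\<^sup>k\<^sup>-\<^sup>1, 2\<^sup>k]\<close>.\<close>

lemma norm_le_energy:
  assumes [measurable]: "g \<in> borel_measurable borel" and g: "\<And>x. 0 \<le> g x"
    and half: "emeasure lborel ({x. 0 < g x} \<inter> cube a l) \<le> ennreal (l ^ CARD('n) / 2)"
    and dense: "\<And>t. 0 < t \<Longrightarrow> AE x in \<mu>. x \<in> {x. t < g x} \<inter> cube a l \<longrightarrow> dyadically_dense {x. t < g x} x"
  shows "(\<integral>\<^sup>+x. indicator (cube a l) x * ennreal (g x powr q) \<partial>\<mu>) epowr (1 / q)
    \<le> 4 * (ennreal (2 * 2 ^ (CARD('n) + 1) * c\<^sub>0 * (1 - \<delta>)) * energy g)"
proof -
  let ?k = "ennreal (2 * 2 ^ (CARD('n) + 1) * c\<^sub>0 * (1 - \<delta>))"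
  define A where "A t = {x. t < g x} \<inter> cube a l" for t
  define u where "u k = (2::real) powr real_of_int k" for k
  define I where "I k = {u (k - 1)<..u k}" for k
  define h where "h t = ?k * energy (indicator {x. t < g x})" for t
  have A [measurable]: "A t \<in> sets borel" for t unfolding A_def by measurable
  have [measurable]: "h \<in> borel_measurable borel"
    unfolding h_def by (intro borel_measurable_times_ennreal energy_indicator_measurable) measurable
  have u: "0 < u k" "u (k + 1) = 2 * u k" "u (k - 1) = u k / 2" for k
    by (simp_all add: u_def powr_add powr_diff)
  have pt: "indicator (cube a l) x * ennreal (g x powr q)
      \<le> (\<integral>\<^sup>+k. ennreal (u (k + 1) powr q) * indicator (A (u k)) x \<partial>count_space UNIV)" for x
  proof (cases "x \<in> cube a l \<and> 0 < g x")
    case True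
    \<comment> \<open>The integer with 2^k < g x \<le> 2^(k+1); the strict lower bound puts
      \<open>x\<close> into \<open>A (u k)\<close>.\<close>
    define k where "k = \<lceil>log 2 (g x)\<rceil> - 1"
    have "real_of_int k < log 2 (g x)" "log 2 (g x) \<le> real_of_int (k + 1)"
      unfolding k_def by linarith+
    then have "u k < g x" "g x \<le> u (k + 1)"
      using True by (auto simp: u_def less_log_iff log_le_iff)
    then have "ennreal (g x powr q) \<le> ennreal (u (k + 1) powr q) * indicator (A (u k)) x"
      using True q by (auto simp: A_def intro!: ennreal_leI powr_mono2)
    also have "\<dots> \<le> (\<integral>\<^sup>+k. ennreal (u (k + 1) powr q) * indicator (A (u k)) x \<partial>count_space UNIV)"
      by (rule le_nn_integral_count_space) simp
    finally show ?thesis using True by simp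
  next
    case False
    then have "x \<notin> cube a l \<or> g x = 0" using g[of x] by auto
    then show ?thesis using q by auto
  qed
  have "(\<integral>\<^sup>+x. indicator (cube a l) x * ennreal (g x powr q) \<partial>\<mu>)
      \<le> (\<integral>\<^sup>+x. \<integral>\<^sup>+k. ennreal (u (k + 1) powr q) * indicator (A (u k)) x \<partial>count_space UNIV \<partial>\<mu>)"
    by (intro nn_integral_mono pt)
  also have "\<dots> = (\<integral>\<^sup>+k. \<integral>\<^sup>+x. ennreal (u (k + 1) powr q) * indicator (A (u k)) x \<partial>\<mu> \<partial>count_space UNIV)"
    by (intro nn_integral_count_space_nn_integral) auto
  also have "\<dots> = (\<integral>\<^sup>+k. ennreal (u (k + 1) powr q) * emeasure \<mu> (A (u k)) \<partial>count_space UNIV)"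
    by (intro nn_integral_cong nn_integral_cmult_indicator) (simp add: sets_\<mu> A)
  finally have "(\<integral>\<^sup>+x. indicator (cube a l) x * ennreal (g x powr q) \<partial>\<mu>) epowr (1 / q)
      \<le> (\<integral>\<^sup>+k. ennreal (u (k + 1) powr q) * emeasure \<mu> (A (u k)) \<partial>count_space UNIV) epowr (1 / q)"
    using q by (intro epowr_mono) auto
  also have "\<dots> \<le> (\<integral>\<^sup>+k. (ennreal (u (k + 1) powr q) * emeasure \<mu> (A (u k))) epowr (1 / q) \<partial>count_space UNIV)"
    using q by (intro epowr_sum_le) auto
  also have "\<dots> \<le> (\<integral>\<^sup>+k. 4 * (\<integral>\<^sup>+t. h t * indicator (I k) t \<partial>lborel) \<partial>count_space UNIV)"
  proof (intro nn_integral_mono)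
    fix k :: int
    let ?m = "emeasure \<mu> (A (u k)) epowr (1 / q)"
    have "(ennreal (u (k + 1) powr q) * emeasure \<mu> (A (u k))) epowr (1 / q) = ennreal (u (k + 1)) * ?m"
      using u(1)[of "k + 1"] q by (subst epowr_mult) (auto simp: powr_powr)
    \<comment> \<open>The value 2^(k+1) is four times the length 2^(k-1) of \<open>I k\<close>,
      which is the origin of the factor 4.\<close>
    also have "\<dots> = 4 * (?m * emeasure lborel (I k))"
    proof -
      have "u (k + 1) = 4 * (u k - u (k - 1))" using u(2,3)[of k] by simp
      moreover have "ennreal (4 * (u k - u (k - 1))) = ennreal 4 * ennreal (u k - u (k - 1))"
        using u[of k] by (intro ennreal_mult) auto
      ultimately have "ennreal (u (k + 1)) = 4 * ennreal (u k - u (k - 1))" by simp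
      moreover have "emeasure lborel (I k) = ennreal (u k - u (k - 1))"
        using u[of k] by (simp add: I_def)
      ultimately show ?thesis by (simp only: mult_ac)
    qed
    also have "?m * emeasure lborel (I k) = (\<integral>\<^sup>+t. ?m * indicator (I k) t \<partial>lborel)"
      by (intro nn_integral_cmult_indicator[symmetric]) (simp add: I_def)
    also have "\<dots> \<le> (\<integral>\<^sup>+t. h t * indicator (I k) t \<partial>lborel)"
    proof (intro nn_integral_mono)
      fix t
      show "?m * indicator (I k) t \<le> h t * indicator (I k) t"
      proof (cases "t \<in> I k")
        case True
        then have t: "0 < t" "t \<le> u k" using u(1)[of "k - 1"] by (auto simp: I_def)
        have "A (u k) \<subseteq> A t" using t by (auto simp: A_def)
        then have "?m \<le> emeasure \<mu> (A t) epowr (1 / q)"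
          using q by (intro epowr_mono emeasure_mono) (auto simp: sets_\<mu> A)
        also have "\<dots> \<le> h t"
          unfolding A_def h_def
        proof (rule set_measure_le_energy)
          have "emeasure lborel ({x. t < g x} \<inter> cube a l) \<le> emeasure lborel ({x. 0 < g x} \<inter> cube a l)"
            using t by (intro emeasure_mono) auto
          also note half
          finally show "emeasure lborel ({x. t < g x} \<inter> cube a l) \<le> ennreal (l ^ CARD('n) / 2)" .
        qed (use dense[OF t(1)] in auto)
        finally show ?thesis using True by simp
      qed simp
    qed
    finally show "(ennreal (u (k + 1) powr q) * emeasure \<mu> (A (u k))) epowr (1 / q)
      \<le> 4 * (\<integral>\<^sup>+t. h t * indicator (I k) t \<partial>lborel)" by (simp add: mult_left_mono)
  qed
  also have "\<dots> = 4 * (\<integral>\<^sup>+k. (\<integral>\<^sup>+t. h t * indicator (I k) t \<partial>lborel) \<partial>count_space UNIV)"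
    by (intro nn_integral_cmult) auto
  also have "(\<integral>\<^sup>+k. (\<integral>\<^sup>+t. h t * indicator (I k) t \<partial>lborel) \<partial>count_space UNIV)
      = (\<integral>\<^sup>+k. emeasure (density lborel h) (I k) \<partial>count_space UNIV)"
    by (intro nn_integral_cong) (simp add: emeasure_density I_def)
  also have "\<dots> = emeasure (density lborel h) (\<Union>k. I k)"
  proof (intro emeasure_UN_countable[symmetric])
    have *: "I j \<inter> I k = {}" if "j < k" for j k
    proof -
      have "u j \<le> u (k - 1)" unfolding u_def using that by (intro powr_mono) auto
      then show ?thesis by (auto simp: I_def)
    qed
    show "disjoint_family I"
      unfolding disjoint_family_on_def by (metis * Int_commute linorder_neqE)
  qed (auto simp: I_def)
  also have "\<dots> \<le> emeasure (density lborel h) {0<..}"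
  proof (intro emeasure_mono)
    show "(\<Union>k. I k) \<subseteq> {0<..}"
    proof
      fix t assume "t \<in> (\<Union>k. I k)"
      then obtain k where "u (k - 1) < t" by (auto simp: I_def)
      with u(1)[of "k - 1"] show "t \<in> {0<..}" by simp
    qed
  qed simp
  also have "\<dots> = (\<integral>\<^sup>+t. h t * indicator {0<..} t \<partial>lborel)"
    by (intro emeasure_density) auto
  also have "\<dots> = (\<integral>\<^sup>+t. ?k * (indicator {0<..} t * energy (indicator {x. t < g x})) \<partial>lborel)"
    unfolding h_def by (intro nn_integral_cong) (simp only: mult_ac)
  also have "\<dots> = ?k * (\<integral>\<^sup>+t. indicator {0<..} t * energy (indicator {x. t < g x}) \<partial>lborel)"
    using energy_indicator_measurable[OF assms(1)]
    by (intro nn_integral_cmult borel_measurable_times_ennreal) auto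
  also have "\<dots> = ?k * energy g" by (simp only: energy_coarea[OF assms(1) g])
  finally show ?thesis by (simp add: mult_left_mono)
qed

end

section \<open>Splitting at a median\<close>

lemma epowr_add_le:
  assumes "0 < p" "p \<le> 1"
  shows "(x + y) epowr p \<le> x epowr p + y epowr p"
  using epowr_sum_le[OF assms, where f = "\<lambda>b. if b then x else y" and A = UNIV]
  by (simp add: nn_integral_count_space_finite UNIV_bool add.commute)

text \<open>m is the infimum of the levels whose strict upper set has at most half of the mass. Both
  strict sets at m are increasing limits: of upper sets at levels above m, and of complements of
  upper sets at levels below m, which carry more than half.\<close>

lemma median_exists:
  fixes f :: "'a \<Rightarrow> real"
  assumes M: "finite_measure M" and [measurable]: "f \<in> borel_measurable M"
  obtains m where "measure M {x\<in>space M. m < f x} \<le> measure M (space M) / 2"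
    "measure M {x\<in>space M. f x < m} \<le> measure M (space M) / 2"
proof (cases "measure M (space M) = 0")
  case True
  interpret finite_measure M by fact
  show ?thesis using that[of 0] True bounded_measure[of "{x\<in>space M. 0 < f x}"] bounded_measure[of "{x\<in>space M. f x < 0}"]
    by simp
next
  case False
  interpret finite_measure M by fact
  define v where "v = measure M (space M)"
  have v: "0 < v" using False measure_nonneg[of M "space M"] unfolding v_def by linarith
  define G where "G t = measure M {x\<in>space M. t < f x}" for t
  define S where "S = {t. G t \<le> v / 2}"
  have anti: "G t \<le> G s" if "s \<le> t" for s t
    unfolding G_def using that by (intro finite_measure_mono) auto
  \<comment> \<open>The limits of \<open>G\<close> at both ends, 0 and the total mass, show that
    \<open>S\<close> is nonempty and bounded below; this is where positive total mass is
    used.\<close>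
  have "(\<lambda>n. G (real n)) \<longlonglongrightarrow> measure M (\<Inter>n. {x\<in>space M. real n < f x})"
    unfolding G_def by (intro finite_Lim_measure_decseq) (auto simp: decseq_def)
  also have "(\<Inter>n. {x\<in>space M. real n < f x}) = {}"
  proof -
    have "\<exists>n. \<not> real n < y" for y using real_arch_simple[of y] by (auto simp: not_less)
    then show ?thesis by blast
  qed
  finally have "eventually (\<lambda>n. G (real n) < v / 2) sequentially"
    using v by (intro order_tendstoD(2)[where a = "v / 2"]) auto
  then obtain n where "G (real n) < v / 2" by (auto simp: eventually_sequentially)
  then have "real n \<in> S" by (simp add: S_def)
  then have ne: "S \<noteq> {}" by blast
  have "(\<lambda>n. G (- real n)) \<longlonglongrightarrow> measure M (\<Union>n. {x\<in>space M. - real n < f x})"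
    unfolding G_def by (intro finite_Lim_measure_incseq) (auto simp: incseq_def)
  also have "(\<Union>n. {x\<in>space M. - real n < f x}) = space M"
  proof -
    have "\<exists>n. - real n < f x" for x
      using reals_Archimedean2[of "- f x"] by (metis minus_less_iff)
    then show ?thesis by auto
  qed
  finally have "eventually (\<lambda>n. v / 2 < G (- real n)) sequentially"
    using v unfolding v_def by (intro order_tendstoD(1)) auto
  then obtain n' where n': "v / 2 < G (- real n')" by (auto simp: eventually_sequentially)
  have bdd: "bdd_below S"
  proof (rule bdd_belowI)
    fix t assume "t \<in> S"
    then show "- real n' \<le> t" using n' anti[of t "- real n'"] by (force simp: S_def)
  qed
  define m where "m = Inf S"
  have above: "G t \<le> v / 2" if mt: "m < t" for t
  proof -
    obtain s where "s \<in> S" "s < t" using mt cInf_lessD[OF ne, of t] unfolding m_def by blast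
    then show ?thesis using anti[of s t] by (auto simp: S_def)
  qed
  have below: "v / 2 < G t" if "t < m" for t
    using that cInf_lower[OF _ bdd, of t] unfolding m_def S_def by force
  have inv: "0 < inverse (real (Suc n))" for n by simp
  have lim1: "(\<lambda>n. G (m + inverse (real (Suc n)))) \<longlonglongrightarrow> measure M (\<Union>n. {x\<in>space M. m + inverse (real (Suc n)) < f x})"
    unfolding G_def by (intro finite_Lim_measure_incseq)
      (auto simp: incseq_def intro: le_less_trans[rotated] add_left_mono le_imp_inverse_le)
  have eq1: "(\<Union>n. {x\<in>space M. m + inverse (real (Suc n)) < f x}) = {x\<in>space M. m < f x}"
  proof -
    have "\<exists>n. m + inverse (real (Suc n)) < y" if "m < y" for y
      using reals_Archimedean[of "y - m"] that by (auto simp: less_diff_eq add.commute)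
    moreover have "m < y" if "m + inverse (real (Suc n)) < y" for n y
      using inv[of n] that by linarith
    ultimately show ?thesis by blast
  qed
  have "measure M {x\<in>space M. m < f x} \<le> v / 2"
    using lim1 unfolding eq1 by (rule LIMSEQ_le_const2) (use above inv in auto)
  moreover
  have lim2: "(\<lambda>n. measure M {x\<in>space M. f x \<le> m - inverse (real (Suc n))}) \<longlonglongrightarrow>
      measure M (\<Union>n. {x\<in>space M. f x \<le> m - inverse (real (Suc n))})"
    by (intro finite_Lim_measure_incseq)
      (auto simp: incseq_def intro: order_trans diff_left_mono le_imp_inverse_le)
  have eq2: "(\<Union>n. {x\<in>space M. f x \<le> m - inverse (real (Suc n))}) = {x\<in>space M. f x < m}"
  proof -
    have "\<exists>n. y \<le> m - inverse (real (Suc n))" if "y < m" for y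
      using reals_Archimedean[of "m - y"] that by (auto simp: less_diff_eq algebra_simps intro: less_imp_le)
    moreover have "y < m" if "y \<le> m - inverse (real (Suc n))" for n y
      using inv[of n] that by linarith
    ultimately show ?thesis by blast
  qed
  have le2: "measure M {x\<in>space M. f x \<le> t} \<le> v / 2" if "t < m" for t
  proof -
    have "measure M {x\<in>space M. f x \<le> t} = measure M (space M - {x\<in>space M. t < f x})"
      by (intro arg_cong[where f = "measure M"]) auto
    also have "\<dots> = v - G t"
      unfolding v_def G_def by (intro finite_measure_compl) auto
    finally show ?thesis using below[OF that] by linarith
  qed
  have "measure M {x\<in>space M. f x < m} \<le> v / 2"
    using lim2 unfolding eq2 by (rule LIMSEQ_le_const2) (use le2 inv in auto)
  ultimately show ?thesis using that unfolding v_def by blast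
qed

context weighted_cube
begin

lemma energy_mono:
  assumes "\<And>x y. \<bar>g x - g y\<bar> \<le> \<bar>f x - f y\<bar>"
  shows "energy g \<le> energy f"
  unfolding energy_def frac_density_def
  by (intro nn_integral_mono mult_right_mono mult_left_mono ennreal_leI divide_right_mono assms) auto

text \<open>The sum is at most three times the maximum. The factor \<open>3 powr q\<close> becomes 3
  under the root of order \<open>q\<close>, so the final constant is free of
  \<open>q\<close>.\<close>

lemma powr_sum3_le:
  fixes x y z :: real
  assumes "0 \<le> x" "0 \<le> y" "0 \<le> z"
  shows "(x + y + z) powr q \<le> 3 powr q * (x powr q + y powr q + z powr q)"
proof -
  define w where "w = max x (max y z)"
  have "x + y + z \<le> 3 * w" by (auto simp: w_def)
  then have "(x + y + z) powr q \<le> (3 * w) powr q"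
    using assms q by (intro powr_mono2) auto
  also have "\<dots> = 3 powr q * w powr q" by (rule powr_mult)
  also have "w powr q \<le> x powr q + y powr q + z powr q"
    by (auto simp: w_def max_def)
  finally show ?thesis by simp
qed

text \<open>With \<open>g1\<close>, \<open>g2\<close> the parts of f - m and \<open>d\<close> the
  distance from median to mean, |f - avg| \<le> g1 + g2 + d. The parts are handled by
  \<open>norm_le_energy\<close>, the constant \<open>d\<close> by
  \<open>integral_le_energy\<close>.\<close>

lemma fractional_poincare_borel:
  assumes f [measurable]: "f \<in> borel_measurable borel"
    and int: "set_integrable lborel (cube a l) f"
    and up: "\<And>t. AE x in \<mu>. x \<in> {x. t < f x} \<inter> cube a l \<longrightarrow> dyadically_dense {x. t < f x} x"
    and down: "\<And>t. AE x in \<mu>. x \<in> {x. f x < t} \<inter> cube a l \<longrightarrow> dyadically_dense {x. f x < t} x"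
  defines "avg \<equiv> (LINT x:cube a l|lborel. f x) / l ^ CARD('n)"
  shows "(\<integral>\<^sup>+x. indicator (cube a l) x * ennreal (\<bar>f x - avg\<bar> powr q) \<partial>\<mu>) epowr (1 / q)
    \<le> ennreal (60 * 2 ^ (CARD('n) + 1) * c\<^sub>0 * (1 - \<delta>)) * energy f"
proof -
  let ?Q = "cube a l" and ?V = "l ^ CARD('n)" and ?Z = "(2::real) ^ (CARD('n) + 1)"
  have V: "0 < ?V" using l by simp
  have Qm [measurable]: "cube a l \<in> sets lborel" by (simp add: sets_cube)
  let ?R = "restrict_space lborel ?Q"
  have R: "finite_measure ?R"
    using l by (intro finite_measureI) (simp add: emeasure_restrict_space emeasure_cube space_restrict_space)
  have sub_meas: "measure ?R {x \<in> space ?R. P x} = measure lborel ({x. P x} \<inter> ?Q)" for P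
    by (subst measure_restrict_space) (auto simp: space_restrict_space Int_def conj_commute)
  obtain m where "measure lborel ({x. m < f x} \<inter> ?Q) \<le> ?V / 2" "measure lborel ({x. f x < m} \<inter> ?Q) \<le> ?V / 2"
  proof (rule median_exists[OF R, of f])
    show "f \<in> borel_measurable ?R" by (intro measurable_restrict_space1) simp
    have "measure ?R (space ?R) = ?V"
      using l by (simp add: emeasure_restrict_space space_restrict_space measure_def emeasure_cube)
    then show "thesis" if "measure ?R {x \<in> space ?R. m < f x} \<le> measure ?R (space ?R) / 2"
      "measure ?R {x \<in> space ?R. f x < m} \<le> measure ?R (space ?R) / 2" for m
      using that that[unfolded sub_meas] \<open>\<And>m. _ \<Longrightarrow> _ \<Longrightarrow> thesis\<close> by simp
  qed
  moreover have "emeasure lborel (A \<inter> ?Q) \<le> ennreal (?V / 2)" if "measure lborel (A \<inter> ?Q) \<le> ?V / 2" "A \<in> sets borel" for A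
  proof -
    have "emeasure lborel (A \<inter> ?Q) \<le> emeasure lborel ?Q" using that by (intro emeasure_mono) auto
    then have "emeasure lborel (A \<inter> ?Q) \<noteq> \<infinity>" using l by (auto simp: emeasure_cube top_unique)
    then show ?thesis using that by (simp add: emeasure_eq_ennreal_measure ennreal_leI)
  qed
  ultimately have m: "emeasure lborel ({x. m < f x} \<inter> ?Q) \<le> ennreal (?V / 2)"
    "emeasure lborel ({x. f x < m} \<inter> ?Q) \<le> ennreal (?V / 2)" by simp_all
  define g1 where "g1 x = max 0 (f x - m)" for x
  define g2 where "g2 x = max 0 (m - f x)" for x
  define d where "d = \<bar>m - avg\<bar>"
  define N where "N g = (\<integral>\<^sup>+x. indicator ?Q x * ennreal (g x powr q) \<partial>\<mu>)" for g
  define M where "M = emeasure \<mu> ?Q epowr (1 / q)"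
  have gm [measurable]: "g1 \<in> borel_measurable borel" "g2 \<in> borel_measurable borel"
    unfolding g1_def g2_def by measurable
  have g0: "0 \<le> g1 x" "0 \<le> g2 x" for x by (simp_all add: g1_def g2_def)
  have s1: "{x. t < g1 x} = {x. m + t < f x}" "{x. t < g2 x} = {x. f x < m - t}" if "0 \<le> t" for t
    using that by (auto simp: g1_def g2_def)
  have e: "energy g1 \<le> energy f" "energy g2 \<le> energy f"
    by (intro energy_mono; auto simp: g1_def g2_def max_def abs_if)+
  have n1: "N g1 epowr (1 / q) \<le> 4 * (ennreal (2 * ?Z * c\<^sub>0 * (1 - \<delta>)) * energy f)"
  proof -
    have "N g1 epowr (1 / q) \<le> 4 * (ennreal (2 * ?Z * c\<^sub>0 * (1 - \<delta>)) * energy g1)"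
      unfolding N_def using m up by (intro norm_le_energy g0 gm) (simp_all add: s1)
    also have "\<dots> \<le> 4 * (ennreal (2 * ?Z * c\<^sub>0 * (1 - \<delta>)) * energy f)" by (intro mult_left_mono e) auto
    finally show ?thesis .
  qed
  have n2: "N g2 epowr (1 / q) \<le> 4 * (ennreal (2 * ?Z * c\<^sub>0 * (1 - \<delta>)) * energy f)"
  proof -
    have "N g2 epowr (1 / q) \<le> 4 * (ennreal (2 * ?Z * c\<^sub>0 * (1 - \<delta>)) * energy g2)"
      unfolding N_def using m down by (intro norm_le_energy g0 gm) (simp_all add: s1)
    also have "\<dots> \<le> 4 * (ennreal (2 * ?Z * c\<^sub>0 * (1 - \<delta>)) * energy f)" by (intro mult_left_mono e) auto
    finally show ?thesis .
  qed
  have a1: "(\<integral>\<^sup>+x. indicator ?Q x * ennreal (g1 x) \<partial>lborel) * M \<le> ennreal (2 * c\<^sub>0 * (1 - \<delta>) * ?V) * energy f"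
    unfolding M_def using m
    by (intro order_trans[OF integral_le_energy mult_left_mono[OF e(1)]] g0 gm) (simp_all add: s1)
  have a2: "(\<integral>\<^sup>+x. indicator ?Q x * ennreal (g2 x) \<partial>lborel) * M \<le> ennreal (2 * c\<^sub>0 * (1 - \<delta>) * ?V) * energy f"
    unfolding M_def using m
    by (intro order_trans[OF integral_le_energy mult_left_mono[OF e(2)]] g0 gm) (simp_all add: s1)
  \<comment> \<open>The mean of f - m is avg - m, and |f - m| = g1 + g2.\<close>
  have dV: "ennreal d * ennreal ?V \<le> (\<integral>\<^sup>+x. indicator ?Q x * ennreal (g1 x) \<partial>lborel) + (\<integral>\<^sup>+x. indicator ?Q x * ennreal (g2 x) \<partial>lborel)"
  proof -
    have cint: "set_integrable lborel ?Q (\<lambda>x. m)"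
      unfolding set_integrable_def using l by (intro integrable_scaleR_left integrable_real_indicator) (auto simp: emeasure_cube)
    have "(LINT x:?Q|lborel. f x - m) = (LINT x:?Q|lborel. f x) - (LINT x:?Q|lborel. m)"
      by (rule set_integral_diff(2)[OF int cint])
    also have "(LINT x:?Q|lborel. m) = ?V * m"
      using l by (simp add: set_lebesgue_integral_def measure_def emeasure_cube)
    finally have "(LINT x:?Q|lborel. f x - m) = (LINT x:?Q|lborel. f x) - ?V * m" .
    moreover have "avg * ?V = (LINT x:?Q|lborel. f x)" using l by (simp add: avg_def)
    ultimately have "(avg - m) * ?V = (LINT x:?Q|lborel. f x - m)"
      by (simp add: left_diff_distrib mult.commute)
    moreover have "d * ?V = \<bar>(avg - m) * ?V\<bar>"
      unfolding abs_mult d_def using V by (simp only: abs_minus_commute[of m] abs_of_pos)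
    ultimately have "d * ?V = norm (LINT x:?Q|lborel. f x - m)" by simp
    moreover have "ennreal d * ennreal ?V = ennreal (d * ?V)"
      using V by (intro ennreal_mult[symmetric]) (auto simp: d_def)
    ultimately have "ennreal d * ennreal ?V = ennreal (norm (LINT x:?Q|lborel. f x - m))" by simp
    also have "\<dots> \<le> (\<integral>\<^sup>+x. ennreal (norm (indicator ?Q x *\<^sub>R (f x - m))) \<partial>lborel)"
      unfolding set_lebesgue_integral_def
      by (intro integral_norm_bound_ennreal) (use set_integral_diff(1)[OF int cint] in \<open>simp add: set_integrable_def\<close>)
    also have "\<dots> = (\<integral>\<^sup>+x. indicator ?Q x * ennreal (g1 x) + indicator ?Q x * ennreal (g2 x) \<partial>lborel)"
      by (intro nn_integral_cong) (auto simp: g1_def g2_def indicator_def max_def)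
    also have "\<dots> = (\<integral>\<^sup>+x. indicator ?Q x * ennreal (g1 x) \<partial>lborel) + (\<integral>\<^sup>+x. indicator ?Q x * ennreal (g2 x) \<partial>lborel)"
      by (intro nn_integral_add) measurable
    finally show ?thesis .
  qed
  \<comment> \<open>The norm of a constant is \<open>d\<close> times \<open>M\<close>; after
    multiplication by the volume the L1 bounds \<open>a1\<close> and \<open>a2\<close> apply, and
    the volume cancels.\<close>
  have n3: "N (\<lambda>x. d) epowr (1 / q) \<le> ennreal (4 * c\<^sub>0 * (1 - \<delta>)) * energy f"
  proof -
    let ?I1 = "\<integral>\<^sup>+x. indicator ?Q x * ennreal (g1 x) \<partial>lborel" and ?I2 = "\<integral>\<^sup>+x. indicator ?Q x * ennreal (g2 x) \<partial>lborel"
    have "N (\<lambda>x. d) epowr (1 / q) = (ennreal (d powr q) * emeasure \<mu> ?Q) epowr (1 / q)"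
      unfolding N_def by (subst mult.commute, subst nn_integral_cmult_indicator) (simp_all add: sets_\<mu> sets_cube)
    also have "\<dots> = ennreal d * M"
    proof (cases "d = 0")
      case False
      then have "0 < d" by (auto simp: d_def)
      then show ?thesis using q by (simp add: epowr_mult M_def powr_powr)
    qed (simp add: ennreal_powr_def)
    finally have N: "N (\<lambda>x. d) epowr (1 / q) = ennreal d * M" .
    have "ennreal ?V * (ennreal d * M) = (ennreal d * ennreal ?V) * M" by (simp only: mult_ac)
    also have "\<dots> \<le> (?I1 + ?I2) * M" by (intro mult_right_mono dV) auto
    also have "\<dots> = ?I1 * M + ?I2 * M" by (rule distrib_right)
    also have "\<dots> \<le> ennreal (2 * c\<^sub>0 * (1 - \<delta>) * ?V) * energy f + ennreal (2 * c\<^sub>0 * (1 - \<delta>) * ?V) * energy f"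
      by (intro add_mono a1 a2)
    also have "\<dots> = ennreal (2 * c\<^sub>0 * (1 - \<delta>) * ?V + 2 * c\<^sub>0 * (1 - \<delta>) * ?V) * energy f"
      using c\<^sub>0_pos \<delta> V by (subst ennreal_plus) (auto simp: distrib_right)
    also have "2 * c\<^sub>0 * (1 - \<delta>) * ?V + 2 * c\<^sub>0 * (1 - \<delta>) * ?V = ?V * (4 * c\<^sub>0 * (1 - \<delta>))" by simp
    also have "ennreal (?V * (4 * c\<^sub>0 * (1 - \<delta>))) * energy f = ennreal ?V * (ennreal (4 * c\<^sub>0 * (1 - \<delta>)) * energy f)"
      using c\<^sub>0_pos \<delta> V by (subst ennreal_mult) (auto simp: mult.assoc)
    finally show ?thesis
      unfolding N using l by (subst (asm) ennreal_mult_le_mult_iff) auto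
  qed
  have "(\<integral>\<^sup>+x. indicator ?Q x * ennreal (\<bar>f x - avg\<bar> powr q) \<partial>\<mu>) \<le>
      (\<integral>\<^sup>+x. ennreal (3 powr q) * (indicator ?Q x * ennreal (g1 x powr q) + (indicator ?Q x * ennreal (g2 x powr q) +
        indicator ?Q x * ennreal (d powr q))) \<partial>\<mu>)"
  proof (intro nn_integral_mono)
    fix x
    have "\<bar>f x - avg\<bar> \<le> g1 x + g2 x + d" by (auto simp: g1_def g2_def d_def)
    then have "\<bar>f x - avg\<bar> powr q \<le> (g1 x + g2 x + d) powr q" using q by (intro powr_mono2) auto
    also have "\<dots> \<le> 3 powr q * (g1 x powr q + g2 x powr q + d powr q)"
      by (intro powr_sum3_le g0) (simp add: d_def)
    finally have "ennreal (\<bar>f x - avg\<bar> powr q) \<le> ennreal (3 powr q * (g1 x powr q + g2 x powr q + d powr q))"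
      by (rule ennreal_leI)
    also have "\<dots> = ennreal (3 powr q) * (ennreal (g1 x powr q) + (ennreal (g2 x powr q) + ennreal (d powr q)))"
      by (simp add: ennreal_mult ennreal_plus add.assoc)
    finally show "indicator ?Q x * ennreal (\<bar>f x - avg\<bar> powr q) \<le>
      ennreal (3 powr q) * (indicator ?Q x * ennreal (g1 x powr q) + (indicator ?Q x * ennreal (g2 x powr q) +
        indicator ?Q x * ennreal (d powr q)))"
      by (cases "x \<in> ?Q") auto
  qed
  also have "\<dots> = ennreal (3 powr q) * (N g1 + (N g2 + N (\<lambda>x. d)))"
    unfolding N_def by (simp add: nn_integral_cmult nn_integral_add sets_\<mu> sets_cube)
  finally have "(\<integral>\<^sup>+x. indicator ?Q x * ennreal (\<bar>f x - avg\<bar> powr q) \<partial>\<mu>) epowr (1 / q)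
      \<le> (ennreal (3 powr q) * (N g1 + (N g2 + N (\<lambda>x. d)))) epowr (1 / q)"
    using q by (intro epowr_mono) auto
  also have "\<dots> = 3 * (N g1 + (N g2 + N (\<lambda>x. d))) epowr (1 / q)"
    using q by (subst epowr_mult) (simp_all add: powr_powr)
  also have "\<dots> \<le> 3 * (N g1 epowr (1 / q) + (N g2 epowr (1 / q) + N (\<lambda>x. d) epowr (1 / q)))"
    using q by (intro mult_left_mono order_trans[OF epowr_add_le add_left_mono[OF epowr_add_le]]) auto
  also have "\<dots> \<le> 3 * (4 * (ennreal (2 * ?Z * c\<^sub>0 * (1 - \<delta>)) * energy f) +
      (4 * (ennreal (2 * ?Z * c\<^sub>0 * (1 - \<delta>)) * energy f) + ennreal (4 * c\<^sub>0 * (1 - \<delta>)) * energy f))"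
    by (intro mult_left_mono add_mono n1 n2 n3) auto
  also have "\<dots> = ennreal (3 * (4 * (2 * ?Z * c\<^sub>0 * (1 - \<delta>)) + (4 * (2 * ?Z * c\<^sub>0 * (1 - \<delta>)) + 4 * c\<^sub>0 * (1 - \<delta>)))) * energy f"
  proof -
    have "3 * (4 * (ennreal A * X) + (4 * (ennreal A * X) + ennreal B * X)) = ennreal (3 * (4 * A + (4 * A + B))) * X"
      if "0 \<le> A" "0 \<le> B" for A B X
    proof -
      have "ennreal (3 * (4 * A + (4 * A + B))) = 3 * (4 * ennreal A + (4 * ennreal A + ennreal B))"
        using that by (simp only: ennreal_plus ennreal_mult' ennreal_numeral add_nonneg_nonneg
          mult_nonneg_nonneg zero_le_numeral)
      then show ?thesis by (simp only: distrib_right distrib_left mult.assoc)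
    qed
    then show ?thesis using c\<^sub>0_pos \<delta> by (simp only: less_imp_le mult_nonneg_nonneg zero_le_numeral zero_le_power diff_ge_0_iff_ge)
  qed
  \<comment> \<open>The total is 3 (8Z + 8Z + 4) with Z = 2^(n+1) \<ge> 1, hence at most 60
    Z.\<close>
  also have "\<dots> \<le> ennreal (60 * ?Z * c\<^sub>0 * (1 - \<delta>)) * energy f"
  proof (intro mult_right_mono ennreal_leI)
    have "1 * (c\<^sub>0 * (1 - \<delta>)) \<le> ?Z * (c\<^sub>0 * (1 - \<delta>))"
      using c\<^sub>0_pos \<delta> by (intro mult_right_mono one_le_power) auto
    moreover have "3 * (4 * (2 * y) + (4 * (2 * y) + 4 * x)) \<le> 60 * y" if "1 * x \<le> y" for x y :: real
      using that by simp
    ultimately show "3 * (4 * (2 * ?Z * c\<^sub>0 * (1 - \<delta>)) + (4 * (2 * ?Z * c\<^sub>0 * (1 - \<delta>)) + 4 * c\<^sub>0 * (1 - \<delta>)))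
      \<le> 60 * ?Z * c\<^sub>0 * (1 - \<delta>)" unfolding mult.assoc by blast
  qed simp
  finally show ?thesis .
qed

end

theorem theorem4p1:
  shows "\<exists>C::real. C > 0 \<and>
    (\<forall>(\<delta>::real) (q::real) (\<alpha>::real) (f :: real ^ 'n \<Rightarrow> real) (\<mu> :: (real ^ 'n) measure)
        (a :: real ^ 'n) (l::real).
       0 \<le> \<delta> \<and> \<delta> < 1 \<and>
       1 \<le> q \<and> q \<le> real CARD('n) / (real CARD('n) - \<delta>) \<and>
       \<alpha> = real CARD('n) - q * (real CARD('n) - \<delta>) \<and>
       radon_measure \<mu> \<and>
       (locally_integrable f \<and> absolutely_continuous lborel \<mu> \<or> continuous_on UNIV f) \<and>
       l > 0 \<longrightarrow>
       (\<integral>\<^sup>+x\<in>cube a l. ennreal (\<bar>f x - average f (cube a l)\<bar> powr q) \<partial>completion \<mu>) epowr (1 / q)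
       \<le> ennreal (C * (1 - \<delta>)) *
         (\<integral>\<^sup>+x\<in>cube a l.
            (\<integral>\<^sup>+y\<in>cube a l.
               ennreal (\<bar>f x - f y\<bar> / norm (x - y) powr (real CARD('n) + \<delta>)) \<partial>lebesgue) *
            dyadic_frac_maximal \<alpha> a l \<mu> x epowr (1 / q) \<partial>lebesgue))"
proof -
  define c\<^sub>0 where "c\<^sub>0 = 2 * real CARD('n) ^ (CARD('n) + 1)"
  define C where "C = 60 * 2 ^ (CARD('n) + 1) * c\<^sub>0"
  have "0 < C" by (simp add: C_def c\<^sub>0_def)
  moreover
  have "(\<integral>\<^sup>+x\<in>cube a l. ennreal (\<bar>f x - average f (cube a l)\<bar> powr q) \<partial>completion \<mu>) epowr (1 / q)
       \<le> ennreal (C * (1 - \<delta>)) *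
         (\<integral>\<^sup>+x\<in>cube a l.
            (\<integral>\<^sup>+y\<in>cube a l.
               ennreal (\<bar>f x - f y\<bar> / norm (x - y) powr (real CARD('n) + \<delta>)) \<partial>lebesgue) *
            dyadic_frac_maximal \<alpha> a l \<mu> x epowr (1 / q) \<partial>lebesgue)"
    if H: "0 \<le> \<delta> \<and> \<delta> < 1 \<and>
       1 \<le> q \<and> q \<le> real CARD('n) / (real CARD('n) - \<delta>) \<and>
       \<alpha> = real CARD('n) - q * (real CARD('n) - \<delta>) \<and>
       radon_measure \<mu> \<and>
       (locally_integrable f \<and> absolutely_continuous lborel \<mu> \<or> continuous_on UNIV f) \<and>
       l > 0"
    for \<delta> q \<alpha> :: real and f :: "real ^ 'n \<Rightarrow> real" and \<mu> :: "(real ^ 'n) measure"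
      and a :: "real ^ 'n" and l :: real
  proof -
    let ?Q = "cube a l"
    have cpt: "compact ?Q" by (simp add: cube_def)
    have "sets \<mu> = sets borel" "emeasure \<mu> ?Q < top"
      using H cpt unfolding radon_measure_def by blast+
    then interpret weighted_cube \<delta> q \<alpha> \<mu> a l c\<^sub>0
      by unfold_locales (use H in \<open>auto simp: c\<^sub>0_def\<close>)
    \<comment> \<open>In the first alternative \<open>f\<close> is Lebesgue measurable only. It is
      replaced on the cube by a Borel function \<open>g\<close> that agrees with it almost
      everywhere for both measures, and whose level sets are dyadically dense \<mu>-almost
      everywhere.\<close>
    have int_f: "set_integrable lebesgue ?Q f"
      and ex: "\<exists>g. g \<in> borel_measurable borel \<and>
        (AE x in lborel. x \<in> ?Q \<longrightarrow> f x = g x) \<and> (AE x in \<mu>. x \<in> ?Q \<longrightarrow> f x = g x) \<and>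
        (\<forall>t. AE x in \<mu>. x \<in> {x. t < g x} \<inter> ?Q \<longrightarrow> dyadically_dense {x. t < g x} x) \<and>
        (\<forall>t. AE x in \<mu>. x \<in> {x. g x < t} \<inter> ?Q \<longrightarrow> dyadically_dense {x. g x < t} x)"
    proof -
      consider (ac) "locally_integrable f" "absolutely_continuous lborel \<mu>" | (cont) "continuous_on UNIV f"
        using H by blast
      then have "set_integrable lebesgue ?Q f \<and> (\<exists>g. g \<in> borel_measurable borel \<and>
        (AE x in lborel. x \<in> ?Q \<longrightarrow> f x = g x) \<and> (AE x in \<mu>. x \<in> ?Q \<longrightarrow> f x = g x) \<and>
        (\<forall>t. AE x in \<mu>. x \<in> {x. t < g x} \<inter> ?Q \<longrightarrow> dyadically_dense {x. t < g x} x) \<and>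
        (\<forall>t. AE x in \<mu>. x \<in> {x. g x < t} \<inter> ?Q \<longrightarrow> dyadically_dense {x. g x < t} x))"
      proof cases
        case ac
        then have int: "set_integrable lebesgue ?Q f" using cpt by (simp add: locally_integrable_def)
        then have "(\<lambda>x. indicator ?Q x *\<^sub>R f x) \<in> borel_measurable (completion lborel)"
          unfolding set_integrable_def by (rule borel_measurable_integrable)
        then obtain g where g: "g \<in> borel_measurable lborel" "AE x in lborel. indicator ?Q x *\<^sub>R f x = g x"
          using completion_ex_borel_measurable_real by blast
        have gm [measurable]: "g \<in> borel_measurable borel" using g(1) by simp
        \<comment> \<open>Absolute continuity is used here: it carries both the equality of
          \<open>f\<close> and \<open>g\<close> and the density theorem over to \<mu>.\<close>
        have to_\<mu>: "AE x in \<mu>. P x" if "AE x in lborel. P x" for P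
          by (rule absolutely_continuous_AE[OF _ ac(2) that]) (simp add: sets_\<mu>)
        have eq: "AE x in lborel. x \<in> ?Q \<longrightarrow> f x = g x"
          using g(2) by eventually_elim (auto simp: indicator_def)
        have dense: "AE x in \<mu>. x \<in> E \<inter> ?Q \<longrightarrow> dyadically_dense E x" if "E \<in> sets borel" for E
          unfolding dyadically_dense_def
          by (intro to_\<mu> AE_dense_dyadic_subcube that l) (simp_all add: field_simps)
        show ?thesis
          by (intro conjI int exI[of _ g] gm eq to_\<mu>[OF eq] allI dense) measurable
      next
        case cont
        have fm: "f \<in> borel_measurable borel" by (rule borel_measurable_continuous_onI[OF cont])
        have "integrable lborel (\<lambda>x. indicator ?Q x *\<^sub>R f x)"
          by (rule borel_integrable_compact[OF cpt continuous_on_subset[OF cont]]) simp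
        then have int: "set_integrable lebesgue ?Q f"
          unfolding set_integrable_def using fm sets_cube
          by (subst integrable_completion) (auto intro!: borel_measurable_scaleR borel_measurable_indicator)
        \<comment> \<open>An open set contains a whole dyadic subcube through each of its points, of
          relative density 1. No exceptional set arises, so \<mu> can be arbitrary.\<close>
        have dense: "dyadically_dense E x" if E: "open E" "x \<in> E \<inter> ?Q" for E x
        proof -
          obtain b s where bs: "(b, s) \<in> dyadic_subcubes a l" "x \<in> cube b s" "cube b s \<subseteq> E"
            using dyadic_subcube_in_open[of x a l E] E l by auto
          have s: "0 < s" using dyadic_subcube(1)[OF bs(1) l] .
          have "(1::real) < 2 ^ (CARD('n) + 1)" by (intro one_less_power) auto
          then have "1 / 2 ^ (CARD('n) + 1) * s ^ CARD('n) < 1 * s ^ CARD('n)"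
            using s by (intro mult_strict_right_mono) auto
          then have "ennreal (1 / 2 ^ (CARD('n) + 1)) * emeasure lborel (cube b s) < emeasure lborel (E \<inter> cube b s)"
            using bs(3) s by (simp add: emeasure_cube Int_absorb1 ennreal_less_iff flip: ennreal_mult)
          then show ?thesis unfolding dyadically_dense_def using bs by (intro bexI[of _ "(b, s)"]) auto
        qed
        have op: "open {x. t < f x}" "open {x. f x < t}" for t
          by (intro open_Collect_less cont continuous_intros)+
        show ?thesis
          using int fm dense op by (intro conjI exI[of _ f] allI AE_I2 impI) auto
      qed
      then show "set_integrable lebesgue ?Q f" "\<exists>g. g \<in> borel_measurable borel \<and>
        (AE x in lborel. x \<in> ?Q \<longrightarrow> f x = g x) \<and> (AE x in \<mu>. x \<in> ?Q \<longrightarrow> f x = g x) \<and>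
        (\<forall>t. AE x in \<mu>. x \<in> {x. t < g x} \<inter> ?Q \<longrightarrow> dyadically_dense {x. t < g x} x) \<and>
        (\<forall>t. AE x in \<mu>. x \<in> {x. g x < t} \<inter> ?Q \<longrightarrow> dyadically_dense {x. g x < t} x)" by auto
    qed
    from ex obtain g where g [measurable]: "g \<in> borel_measurable borel"
      and eq: "AE x in lborel. x \<in> ?Q \<longrightarrow> f x = g x" and eq_\<mu>: "AE x in \<mu>. x \<in> ?Q \<longrightarrow> f x = g x"
      and up: "\<And>t. AE x in \<mu>. x \<in> {x. t < g x} \<inter> ?Q \<longrightarrow> dyadically_dense {x. t < g x} x"
      and down: "\<And>t. AE x in \<mu>. x \<in> {x. g x < t} \<inter> ?Q \<longrightarrow> dyadically_dense {x. g x < t} x"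
      by blast
    have gQ: "(\<lambda>x. indicator ?Q x *\<^sub>R g x) \<in> borel_measurable lborel" by measurable
    have fQ: "(\<lambda>x. indicator ?Q x *\<^sub>R f x) \<in> borel_measurable lebesgue"
      using int_f unfolding set_integrable_def by (rule borel_measurable_integrable)
    have eqQ: "AE x in lebesgue. indicator ?Q x *\<^sub>R f x = indicator ?Q x *\<^sub>R g x"
      using AE_completion[OF eq] by eventually_elim (auto simp: indicator_def)
    have int_g: "set_integrable lborel ?Q g"
      using int_f unfolding set_integrable_def integrable_cong_AE[OF fQ measurable_completion[OF gQ] eqQ]
      unfolding integrable_completion[OF gQ] .
    have "(LINT x:?Q|lebesgue. f x) = (LINT x:?Q|lborel. g x)"
      unfolding set_lebesgue_integral_def integral_cong_AE[OF fQ measurable_completion[OF gQ] eqQ]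
      by (rule integral_completion[OF gQ])
    moreover have "measure lebesgue ?Q = l ^ CARD('n)"
      using l by (simp add: measure_def emeasure_cube)
    ultimately have avg: "average f ?Q = (LINT x:?Q|lborel. g x) / l ^ CARD('n)"
      by (simp add: average_def)
    have lhs: "(\<integral>\<^sup>+x\<in>?Q. ennreal (\<bar>f x - average f ?Q\<bar> powr q) \<partial>completion \<mu>)
        = (\<integral>\<^sup>+x. indicator ?Q x * ennreal (\<bar>g x - average f ?Q\<bar> powr q) \<partial>\<mu>)"
      unfolding nn_integral_completion using eq_\<mu>
      by (intro nn_integral_cong_AE) (auto elim!: eventually_mono simp: indicator_def)
    \<comment> \<open>\<open>f\<close> is replaced in the variable y for a fixed value
      \<open>g x\<close>; the replacement in x follows in \<open>rhs\<close>, outside a second null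
      set.\<close>
    have inner: "(\<integral>\<^sup>+y\<in>?Q. ennreal (\<bar>g x - f y\<bar> / norm (x - y) powr (real CARD('n) + \<delta>)) \<partial>lebesgue)
        = frac_density \<delta> g ?Q x" for x
      unfolding nn_integral_completion frac_density_def using eq
      by (intro nn_integral_cong_AE) (auto elim!: eventually_mono simp: indicator_def)
    have rhs: "(\<integral>\<^sup>+x\<in>?Q. (\<integral>\<^sup>+y\<in>?Q. ennreal (\<bar>f x - f y\<bar> / norm (x - y) powr (real CARD('n) + \<delta>)) \<partial>lebesgue) *
            dyadic_frac_maximal \<alpha> a l \<mu> x epowr (1 / q) \<partial>lebesgue) = energy g"
      unfolding energy_def W_def inner[symmetric] nn_integral_completion[of lborel] using eq
      by (intro nn_integral_cong_AE) (auto elim!: eventually_mono simp: indicator_def)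
    show ?thesis
      unfolding lhs rhs C_def unfolding avg by (rule fractional_poincare_borel[OF g int_g up down])
  qed
  ultimately show ?thesis by blast
qed

end
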